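(* Let $\mathcal H$ be an internal complex Hilbert space and $\mathcal M\subseteq\mathcal B(\mathcal H)$ an internal unital $C^*$-algebra. Suppose there exists a sequence $\{p_n\}_{n\in\mathbb N}$ (indexed by the standard natural numbers) of nonzero projections in $\mathcal M$ with mutually orthogonal ranges (i.e. $p_np_m=0$ whenever $n\neq m$). Then the nonstandard hull $\widehat{\mathcal M}$ is not a von Neumann algebra.
   Context: Work in a nonstandard universe (in the sense of Robinson's nonstandard analysis) that is $\kappa$-saturated for a sufficiently large uncountable cardinal $\kappa$. All $C^*$-algebras are unital. For $r,s\in{}^*\mathbb R$, $r\approx s$ means $|r-s|<1/n$ for all standard $n\ge1$; $r$ is finite if $|r|<n$ for some standard $n$; ${}^\circ r$ is the standard part of a finite $r$. For an internal normed space $X$ (such as $\mathcal M$ or $\mathcal H$), $\mathrm{Fin}(X)=\{x\in X:\|x\|\text{ finite}\}$, $x\approx y$ means $\|x-y\|\approx0$, $\widehat x=\{y\in X:y\approx x\}$, and the nonstandard hull is $\widehat X=\{\widehat x:x\in\mathrm{Fin}(X)\}$ with operations induced from representatives and $\|\widehat x\|={}^\circ\|x\|$. Then $\widehat{\mathcal M}$ is an ordinary $C^*$-algebra, $\widehat{\mathcal H}$ is an ordinary Hilbert space with inner product $\langle\widehat x,\widehat y\rangle={}^\circ\langle x,y\rangle$, and $\widehat{\mathcal M}$ is regarded as a $C^*$-subalgebra of $\mathcal B(\widehat{\mathcal H})$ via $\widehat a(\widehat x)=\widehat{a(x)}$. "$\widehat{\mathcal M}$ is a von Neumann algebra" means that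 $\widehat{\mathcal M}$ is closed in $\mathcal B(\widehat{\mathcal H})$ in the strong (equivalently weak) operator topology. *)

theory Defs
  imports "HOL-Analysis.Analysis" "HOL-Algebra.Module"
begin

unbundle cardinal_syntax

section \<open>Complex Hilbert spaces with explicit carriers\<close>

text \<open>
  A (pre-)Hilbert space is a record, so that the same vocabulary serves for standard spaces,
  internal spaces (whose scalars are hypercomplex numbers) and nonstandard hulls (whose vectors are
  sets). The ring fields \<open>mult\<close> and \<open>one\<close> inherited from \<^type>\<open>module\<close> are not used. Inner products are
  linear in the first argument.
\<close>

record ('s, 'v) inner_space = "('s, 'v) module" +
  ip :: "'v \<Rightarrow> 'v \<Rightarrow> 's"

definition complex_ring :: "complex ring" where
  "complex_ring = \<lparr>carrier = UNIV, mult = (*), one = 1, zero = 0, add = (+)\<rparr>"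

definition hnorm :: "(complex, 'v) inner_space \<Rightarrow> 'v \<Rightarrow> real" where
  "hnorm H x = sqrt (Re (ip H x x))"

definition hdist :: "(complex, 'v) inner_space \<Rightarrow> 'v \<Rightarrow> 'v \<Rightarrow> real" where
  "hdist H x y = hnorm H (x \<ominus>\<^bsub>H\<^esub> y)"

definition complex_hilbert_space :: "(complex, 'v) inner_space \<Rightarrow> bool" where
  "complex_hilbert_space H \<longleftrightarrow>
     Module.module complex_ring H \<and>
     (\<forall>x\<in>carrier H. \<forall>y\<in>carrier H. \<forall>z\<in>carrier H.
        ip H (x \<oplus>\<^bsub>H\<^esub> y) z = ip H x z + ip H y z) \<and>
     (\<forall>c. \<forall>x\<in>carrier H. \<forall>y\<in>carrier H. ip H (c \<odot>\<^bsub>H\<^esub> x) y = c * ip H x y) \<and>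
     (\<forall>x\<in>carrier H. \<forall>y\<in>carrier H. ip H y x = cnj (ip H x y)) \<and>
     (\<forall>x\<in>carrier H. 0 \<le> Re (ip H x x)) \<and>
     (\<forall>x\<in>carrier H. ip H x x = 0 \<longrightarrow> x = \<zero>\<^bsub>H\<^esub>) \<and>
     Metric_space.mcomplete (carrier H) (hdist H)"

text \<open>Operators are extensional: they are \<open>undefined\<close> outside the carrier.\<close>

definition bounded_ops :: "(complex, 'v) inner_space \<Rightarrow> ('v \<Rightarrow> 'v) set" where
  "bounded_ops H = {T \<in> carrier H \<rightarrow>\<^sub>E carrier H.
     (\<forall>x\<in>carrier H. \<forall>y\<in>carrier H. T (x \<oplus>\<^bsub>H\<^esub> y) = T x \<oplus>\<^bsub>H\<^esub> T y) \<and>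
     (\<forall>c. \<forall>x\<in>carrier H. T (c \<odot>\<^bsub>H\<^esub> x) = c \<odot>\<^bsub>H\<^esub> T x) \<and>
     (\<exists>B. \<forall>x\<in>carrier H. hnorm H (T x) \<le> B * hnorm H x)}"

definition op_diff :: "('s, 'v) inner_space \<Rightarrow> ('v \<Rightarrow> 'v) \<Rightarrow> ('v \<Rightarrow> 'v) \<Rightarrow> 'v \<Rightarrow> 'v" where
  "op_diff H S T = restrict (\<lambda>x. S x \<ominus>\<^bsub>H\<^esub> T x) (carrier H)"

definition opnorm :: "(complex, 'v) inner_space \<Rightarrow> ('v \<Rightarrow> 'v) \<Rightarrow> real" where
  "opnorm H T = Inf {B. 0 \<le> B \<and> (\<forall>x\<in>carrier H. hnorm H (T x) \<le> B * hnorm H x)}"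

definition op_norm_topology :: "(complex, 'v) inner_space \<Rightarrow> ('v \<Rightarrow> 'v) topology" where
  "op_norm_topology H =
     Metric_space.mtopology (bounded_ops H) (\<lambda>S T. opnorm H (op_diff H S T))"

definition adjoint_pair :: "('s, 'v) inner_space \<Rightarrow> ('v \<Rightarrow> 'v) \<Rightarrow> ('v \<Rightarrow> 'v) \<Rightarrow> bool" where
  "adjoint_pair H S T \<longleftrightarrow> (\<forall>x\<in>carrier H. \<forall>y\<in>carrier H. ip H (S x) y = ip H x (T y))"

text \<open>The unit of the algebra is not required to be the identity operator of the space.\<close>

definition unital_cstar_algebra_on ::
    "(complex, 'v) inner_space \<Rightarrow> ('v \<Rightarrow> 'v) set \<Rightarrow> bool" where
  "unital_cstar_algebra_on H M \<longleftrightarrow>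
     M \<subseteq> bounded_ops H \<and>
     (\<forall>S\<in>M. \<forall>T\<in>M. restrict (\<lambda>x. S x \<oplus>\<^bsub>H\<^esub> T x) (carrier H) \<in> M) \<and>
     (\<forall>c. \<forall>T\<in>M. restrict (\<lambda>x. c \<odot>\<^bsub>H\<^esub> T x) (carrier H) \<in> M) \<and>
     (\<forall>S\<in>M. \<forall>T\<in>M. compose (carrier H) S T \<in> M) \<and>
     (\<forall>S\<in>M. \<exists>T\<in>M. adjoint_pair H S T) \<and>
     (\<exists>e\<in>M. \<forall>T\<in>M. compose (carrier H) e T = T \<and> compose (carrier H) T e = T) \<and>
     closedin (op_norm_topology H) M"

text \<open>
  Projections are the self-adjoint idempotents; \<open>is_projection\<close> is only applied to elements of an
  algebra of operators.
\<close>

definition is_projection :: "('s, 'v) inner_space \<Rightarrow> ('v \<Rightarrow> 'v) \<Rightarrow> bool" where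
  "is_projection H p \<longleftrightarrow> (\<forall>x\<in>carrier H. p (p x) = p x) \<and> adjoint_pair H p p"

text \<open>
  The strong operator topology is the topology of pointwise convergence in norm, that is, the
  subspace topology inherited from the product topology.
\<close>

definition strong_operator_topology :: "(complex, 'v) inner_space \<Rightarrow> ('v \<Rightarrow> 'v) topology" where
  "strong_operator_topology H =
     subtopology
       (product_topology (\<lambda>_. Metric_space.mtopology (carrier H) (hdist H)) (carrier H))
       (bounded_ops H)"

definition von_neumann_algebra_on ::
    "(complex, 'v) inner_space \<Rightarrow> ('v \<Rightarrow> 'v) set \<Rightarrow> bool" where
  "von_neumann_algebra_on H M \<longleftrightarrow> closedin (strong_operator_topology H) M"


section \<open>Nonstandard universes\<close>

text \<open>
  The elements of \<open>'a\<close> are the standard objects, those of \<open>'b\<close> the internal objects; \<open>'a\<close> is an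
  arbitrary type (for instance a sufficiently high level of a superstructure, with membership being
  one of the relations) which contains the complex numbers through \<open>num\<close>. Every standard object
  \<open>a\<close> has an extension \<open>elem_star a\<close>, and every relation \<open>R\<close>, of any arity, between standard
  objects has an extension \<open>rel_star R\<close>. Relations are predicates on lists; their restriction to
  lists of length \<open>n\<close> is an \<open>n\<close>-ary relation.
\<close>

record ('a, 'b) nonstandard_universe =
  elem_star :: "'a \<Rightarrow> 'b"
  rel_star :: "('a list \<Rightarrow> bool) \<Rightarrow> 'b list \<Rightarrow> bool"
  num :: "complex \<Rightarrow> 'a"

text \<open>First-order formulas whose relation symbols are all relations on \<open>'a\<close>.\<close>

datatype 'a formula =
    Rel "'a list \<Rightarrow> bool" "nat list"
  | Equal nat nat
  | Neg "'a formula"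
  | Conj "'a formula" "'a formula"
  | Forall nat "'a formula"

primrec sat :: "(('a list \<Rightarrow> bool) \<Rightarrow> 'c list \<Rightarrow> bool) \<Rightarrow> (nat \<Rightarrow> 'c) \<Rightarrow> 'a formula \<Rightarrow> bool" where
  "sat I e (Rel R vs) \<longleftrightarrow> I R (map e vs)"
| "sat I e (Equal i j) \<longleftrightarrow> e i = e j"
| "sat I e (Neg \<phi>) \<longleftrightarrow> \<not> sat I e \<phi>"
| "sat I e (Conj \<phi> \<psi>) \<longleftrightarrow> sat I e \<phi> \<and> sat I e \<psi>"
| "sat I e (Forall n \<phi>) \<longleftrightarrow> (\<forall>x. sat I (e(n := x)) \<phi>)"

definition transfer_principle :: "('a, 'b) nonstandard_universe \<Rightarrow> bool" where
  "transfer_principle U \<longleftrightarrow>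
     (\<forall>\<phi> e. sat (\<lambda>R. R) e \<phi> \<longleftrightarrow> sat (rel_star U) (elem_star U \<circ> e) \<phi>)"

text \<open>
  An internal set is the section of an extended relation at a list of internal parameters.
\<close>

definition internal_set :: "('a, 'b) nonstandard_universe \<Rightarrow> 'b set \<Rightarrow> bool" where
  "internal_set U A \<longleftrightarrow> (\<exists>R ps. A = {x. rel_star U R (x # ps)})"

definition saturated :: "('a, 'b) nonstandard_universe \<Rightarrow> 'k rel \<Rightarrow> bool" where
  "saturated U \<kappa> \<longleftrightarrow>
     (\<forall>\<F>. (\<forall>A\<in>\<F>. internal_set U A) \<and> |\<F>| <o \<kappa> \<and>
          (\<forall>\<G>. \<G> \<subseteq> \<F> \<and> finite \<G> \<longrightarrow> \<Inter>\<G> \<noteq> {}) \<longrightarrow> \<Inter>\<F> \<noteq> {})"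

definition nonstandard_universe ::
    "('a, 'b) nonstandard_universe \<Rightarrow> 'k rel \<Rightarrow> bool" where
  "nonstandard_universe U \<kappa> \<longleftrightarrow>
     inj (num U) \<and> transfer_principle U \<and> Card_order \<kappa> \<and> natLeq <o \<kappa> \<and> saturated U \<kappa>"

text \<open>The extension of a function is the function whose graph is the extension of the graph.\<close>

definition fun_star :: "('a, 'b) nonstandard_universe \<Rightarrow> ('a list \<Rightarrow> 'a) \<Rightarrow> 'b list \<Rightarrow> 'b" where
  "fun_star U f xs = (THE y. rel_star U (\<lambda>l. hd l = f (tl l)) (y # xs))"

definition set_star :: "('a, 'b) nonstandard_universe \<Rightarrow> 'a set \<Rightarrow> 'b set" where
  "set_star U A = {x. rel_star U (\<lambda>l. l ! 0 \<in> A) [x]}"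

section \<open>Hypercomplex numbers\<close>

definition cnum :: "('a, 'b) nonstandard_universe \<Rightarrow> complex \<Rightarrow> 'b" where
  "cnum U z = elem_star U (num U z)"

abbreviation denum :: "('a, 'b) nonstandard_universe \<Rightarrow> 'a \<Rightarrow> complex" where
  "denum U \<equiv> inv_into UNIV (num U)"

definition hc_lift1 ::
    "('a, 'b) nonstandard_universe \<Rightarrow> (complex \<Rightarrow> complex) \<Rightarrow> 'b \<Rightarrow> 'b" where
  "hc_lift1 U f z = fun_star U (\<lambda>l. num U (f (denum U (l ! 0)))) [z]"

definition hc_lift2 ::
    "('a, 'b) nonstandard_universe \<Rightarrow> (complex \<Rightarrow> complex \<Rightarrow> complex) \<Rightarrow> 'b \<Rightarrow> 'b \<Rightarrow> 'b" where
  "hc_lift2 U f z w =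
     fun_star U (\<lambda>l. num U (f (denum U (l ! 0)) (denum U (l ! 1)))) [z, w]"

text \<open>The orders on the hyperreals, which are a subset of the hypercomplex numbers.\<close>

definition hr_less :: "('a, 'b) nonstandard_universe \<Rightarrow> 'b \<Rightarrow> 'b \<Rightarrow> bool" where
  "hr_less U r s \<longleftrightarrow>
     rel_star U (\<lambda>l. \<exists>x y :: real. l ! 0 = num U (of_real x) \<and> l ! 1 = num U (of_real y) \<and> x < y)
       [r, s]"

definition hr_le :: "('a, 'b) nonstandard_universe \<Rightarrow> 'b \<Rightarrow> 'b \<Rightarrow> bool" where
  "hr_le U r s \<longleftrightarrow>
     rel_star U (\<lambda>l. \<exists>x y :: real. l ! 0 = num U (of_real x) \<and> l ! 1 = num U (of_real y) \<and> x \<le> y)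
       [r, s]"

definition hc_abs :: "('a, 'b) nonstandard_universe \<Rightarrow> 'b \<Rightarrow> 'b" where
  "hc_abs U = hc_lift1 U (\<lambda>z. of_real (cmod z))"

definition hc_finite :: "('a, 'b) nonstandard_universe \<Rightarrow> 'b \<Rightarrow> bool" where
  "hc_finite U z \<longleftrightarrow> (\<exists>n::nat. hr_less U (hc_abs U z) (cnum U (of_nat n)))"

definition hc_approx :: "('a, 'b) nonstandard_universe \<Rightarrow> 'b \<Rightarrow> 'b \<Rightarrow> bool" where
  "hc_approx U z w \<longleftrightarrow>
     (\<forall>n::nat. n \<ge> 1 \<longrightarrow> hr_less U (hc_abs U (hc_lift2 U (-) z w)) (cnum U (1 / of_nat n)))"

definition standard_part :: "('a, 'b) nonstandard_universe \<Rightarrow> 'b \<Rightarrow> complex" where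
  "standard_part U z = (THE w. hc_approx U z (cnum U w))"


section \<open>Internal Hilbert spaces and internal C*-algebras\<close>

text \<open>
  The extension of a standard family \<open>\<H>\<close> of spaces, evaluated at an internal index \<open>c\<close>.
\<close>

definition hilbert_star ::
    "('a, 'b) nonstandard_universe \<Rightarrow> ('a \<Rightarrow> (complex, 'a) inner_space) \<Rightarrow> 'b
       \<Rightarrow> ('b, 'b) inner_space" where
  "hilbert_star U \<H> c =
     \<lparr>carrier = {x. rel_star U (\<lambda>l. l ! 1 \<in> carrier (\<H> (l ! 0))) [c, x]},
      mult = undefined, one = undefined,
      zero = fun_star U (\<lambda>l. \<zero>\<^bsub>\<H> (l ! 0)\<^esub>) [c],
      add = (\<lambda>x y. fun_star U (\<lambda>l. l ! 1 \<oplus>\<^bsub>\<H> (l ! 0)\<^esub> l ! 2) [c, x, y]),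
      smult = (\<lambda>z x. fun_star U (\<lambda>l. denum U (l ! 1) \<odot>\<^bsub>\<H> (l ! 0)\<^esub> l ! 2) [c, z, x]),
      ip = (\<lambda>x y. fun_star U (\<lambda>l. num U (ip (\<H> (l ! 0)) (l ! 1) (l ! 2))) [c, x, y])\<rparr>"

text \<open>
  Likewise for families of sets of operators. The \<open>j\<close>-th set of the standard family is
  \<open>op j ` K j\<close>; the elements of \<open>K j\<close> serve as names of operators, so that families of sets of
  operators can be described by relations between objects.
\<close>

definition ops_star ::
    "('a, 'b) nonstandard_universe \<Rightarrow> ('a \<Rightarrow> (complex, 'a) inner_space) \<Rightarrow> ('a \<Rightarrow> 'a set)
       \<Rightarrow> ('a \<Rightarrow> 'a \<Rightarrow> 'a \<Rightarrow> 'a) \<Rightarrow> 'b \<Rightarrow> ('b \<Rightarrow> 'b) set" where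
  "ops_star U \<H> K op c =
     (\<lambda>k. restrict (\<lambda>x. fun_star U (\<lambda>l. op (l ! 0) (l ! 1) (l ! 2)) [c, k, x])
            (carrier (hilbert_star U \<H> c)))
       ` {k. rel_star U (\<lambda>l. l ! 1 \<in> K (l ! 0)) [c, k]}"

text \<open>
  \<open>H\<close> is an internal complex Hilbert space and \<open>M\<close> is an internal unital C*-algebra of operators on
  \<open>H\<close>: the pair belongs to the extension of a standard set (indexed by \<open>J\<close>) of pairs consisting of
  a Hilbert space and a unital C*-algebra on it.
\<close>

definition internal_cstar_algebra_on ::
    "('a, 'b) nonstandard_universe \<Rightarrow> ('b, 'b) inner_space \<Rightarrow> ('b \<Rightarrow> 'b) set \<Rightarrow> bool" where
  "internal_cstar_algebra_on U H M \<longleftrightarrow>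
     (\<exists>J \<H> K op.
        (\<forall>j\<in>J. complex_hilbert_space (\<H> j) \<and> unital_cstar_algebra_on (\<H> j) (op j ` K j)) \<and>
        (\<exists>c\<in>set_star U J. H = hilbert_star U \<H> c \<and> M = ops_star U \<H> K op c))"

definition internal_norm :: "('a, 'b) nonstandard_universe \<Rightarrow> ('b, 'b) inner_space \<Rightarrow> 'b \<Rightarrow> 'b" where
  "internal_norm U H x = hc_lift1 U (\<lambda>z. of_real (sqrt (Re z))) (ip H x x)"

definition internal_op_bound ::
    "('a, 'b) nonstandard_universe \<Rightarrow> ('b, 'b) inner_space \<Rightarrow> ('b \<Rightarrow> 'b) \<Rightarrow> 'b \<Rightarrow> bool" where
  "internal_op_bound U H T B \<longleftrightarrow>
     hr_le U (cnum U 0) B \<and>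
     (\<forall>x\<in>carrier H. hr_le U (internal_norm U H (T x)) (hc_lift2 U (*) B (internal_norm U H x)))"

definition internal_opnorm ::
    "('a, 'b) nonstandard_universe \<Rightarrow> ('b, 'b) inner_space \<Rightarrow> ('b \<Rightarrow> 'b) \<Rightarrow> 'b" where
  "internal_opnorm U H T =
     (THE B. internal_op_bound U H T B \<and> (\<forall>B'. internal_op_bound U H T B' \<longrightarrow> hr_le U B B'))"


section \<open>Nonstandard hulls\<close>

text \<open>Here \<open>X\<close> is an internal normed space with norm \<open>nrm\<close> and subtraction \<open>diff\<close>.\<close>

definition hat ::
    "('a, 'b) nonstandard_universe \<Rightarrow> 'x set \<Rightarrow> ('x \<Rightarrow> 'x \<Rightarrow> 'x) \<Rightarrow> ('x \<Rightarrow> 'b) \<Rightarrow> 'x \<Rightarrow> 'x set" where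
  "hat U X diff nrm x = {y \<in> X. hc_approx U (nrm (diff y x)) (cnum U 0)}"

definition nonstandard_hull ::
    "('a, 'b) nonstandard_universe \<Rightarrow> 'x set \<Rightarrow> ('x \<Rightarrow> 'x \<Rightarrow> 'x) \<Rightarrow> ('x \<Rightarrow> 'b) \<Rightarrow> 'x set set" where
  "nonstandard_hull U X diff nrm = hat U X diff nrm ` {x \<in> X. hc_finite U (nrm x)}"

definition rep :: "'x set \<Rightarrow> 'x" where
  "rep A = (SOME x. x \<in> A)"

definition vec_hat ::
    "('a, 'b) nonstandard_universe \<Rightarrow> ('b, 'b) inner_space \<Rightarrow> 'b \<Rightarrow> 'b set" where
  "vec_hat U H = hat U (carrier H) (\<lambda>x y. x \<ominus>\<^bsub>H\<^esub> y) (internal_norm U H)"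

definition hilbert_hull ::
    "('a, 'b) nonstandard_universe \<Rightarrow> ('b, 'b) inner_space \<Rightarrow> (complex, 'b set) inner_space" where
  "hilbert_hull U H =
     \<lparr>carrier = nonstandard_hull U (carrier H) (\<lambda>x y. x \<ominus>\<^bsub>H\<^esub> y) (internal_norm U H),
      mult = undefined, one = undefined,
      zero = vec_hat U H \<zero>\<^bsub>H\<^esub>,
      add = (\<lambda>A B. vec_hat U H (rep A \<oplus>\<^bsub>H\<^esub> rep B)),
      smult = (\<lambda>z A. vec_hat U H (cnum U z \<odot>\<^bsub>H\<^esub> rep A)),
      ip = (\<lambda>A B. standard_part U (ip H (rep A) (rep B)))\<rparr>"

definition op_hat ::
    "('a, 'b) nonstandard_universe \<Rightarrow> ('b, 'b) inner_space \<Rightarrow> ('b \<Rightarrow> 'b) \<Rightarrow> 'b set \<Rightarrow> 'b set" where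
  "op_hat U H a = restrict (\<lambda>A. vec_hat U H (a (rep A))) (carrier (hilbert_hull U H))"

text \<open>
  The nonstandard hull of \<open>M\<close>, regarded as an algebra of operators on the nonstandard hull of \<open>H\<close>.
\<close>

definition algebra_hull ::
    "('a, 'b) nonstandard_universe \<Rightarrow> ('b, 'b) inner_space \<Rightarrow> ('b \<Rightarrow> 'b) set
       \<Rightarrow> ('b set \<Rightarrow> 'b set) set" where
  "algebra_hull U H M =
     (\<lambda>A. op_hat U H (rep A)) ` nonstandard_hull U M (op_diff H) (internal_opnorm U H)"

end

theory Submission
  imports Defs "HOL-Library.Countable_Set_Type"
begin

text \<open>
  Let \<open>q\<^sub>n = p\<^sub>0 + \<dots> + p\<^sub>n\<close>. On the hull the projections \<open>q\<^sub>n\<close> converge strongly to an operator \<open>P\<close>.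
  By saturation, on every finite set of vectors \<open>P\<close> agrees with the hull of an internal operator in
  the algebra that has norm at most 1; hence \<open>P\<close> lies in the strong closure of the hull of the algebra.
  If \<open>P\<close> were itself the hull of an internal \<open>a\<close> of finite norm, then \<open>a u\<^sub>n \<approx> u\<^sub>n\<close> for unit
  vectors \<open>u\<^sub>n\<close> in the range of \<open>p\<^sub>n\<close>, and saturation would give a unit vector \<open>r\<close> with
  \<open>a r \<approx> r\<close> and \<open>p\<^sub>n r = 0\<close> for all standard \<open>n\<close>. Then \<open>P\<close> annihilates and fixes the class of \<open>r\<close>,
  a contradiction.
\<close>

section \<open>Transfer\<close>

text \<open>The universe is given by axioms alone, so internal spaces have no ultraproduct
  coordinates to compute in. The filter \<open>F\<close> restores them: a point \<open>e\<close>
  evaluates internal objects to standard ones, and a Los theorem holds along \<open>F\<close>. Each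
  internal statement is then proved in the ordinary Hilbert space \<open>\<H> (e c)\<close> for
  eventually all \<open>e\<close>, and infinite closeness becomes convergence along
  \<open>F\<close>. The \<open>q\<^sub>n\<close> converge because the standard parts of the squared
  norms of \<open>q\<^sub>n x\<close> increase and stay bounded. How fast depends on
  \<open>x\<close>, and no threshold serves all vectors; finitely many vectors, however, have common
  thresholds, and saturation can meet the resulting countable list of conditions. Finite sets of
  vectors are also what the topology of pointwise convergence tests. The bound 1 on the norm keeps
  the interpolating operators finite and passes to \<open>P\<close>.\<close>

fun formula_vars :: "'a formula \<Rightarrow> nat set" where
  "formula_vars (Rel R vs) = set vs"
| "formula_vars (Equal i j) = {i, j}"
| "formula_vars (Neg \<phi>) = formula_vars \<phi>"
| "formula_vars (Conj \<phi> \<psi>) = formula_vars \<phi> \<union> formula_vars \<psi>"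
| "formula_vars (Forall n \<phi>) = insert n (formula_vars \<phi>)"

lemma finite_formula_vars: "finite (formula_vars \<phi>)"
  by (induction \<phi>) auto

lemma sat_cong:
  "(\<And>i. i \<in> formula_vars \<phi> \<Longrightarrow> e i = e' i) \<Longrightarrow> sat I e \<phi> \<longleftrightarrow> sat I e' \<phi>"
proof (induction \<phi> arbitrary: e e')
  case (Rel R vs)
  then have "map e vs = map e' vs" by simp
  then show ?case by (simp only: sat.simps)
next
  case (Forall n \<phi>)
  have "sat I (e(n := x)) \<phi> = sat I (e'(n := x)) \<phi>" for x
    by (rule Forall.IH) (use Forall.prems in auto)
  then show ?case by simp
next
  case (Neg \<phi>)
  have "sat I e \<phi> = sat I e' \<phi>" by (rule Neg.IH) (use Neg.prems in auto)
  then show ?case by simp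
next
  case (Conj \<phi> \<psi>)
  have "sat I e \<phi> = sat I e' \<phi>" "sat I e \<psi> = sat I e' \<psi>"
    by (rule Conj.IH; use Conj.prems in auto)+
  then show ?case by simp
qed auto

lemma sat_foldr_Forall:
  "sat I e (foldr Forall ns \<phi>) \<longleftrightarrow> (\<forall>e'. (\<forall>i. i \<notin> set ns \<longrightarrow> e' i = e i) \<longrightarrow> sat I e' \<phi>)"
proof (induction ns arbitrary: e)
  case Nil
  have "(\<forall>i. e' i = e i) \<longleftrightarrow> e' = e" for e' by auto
  then show ?case by simp
next
  case (Cons n ns)
  show ?case
    unfolding foldr.simps o_apply sat.simps Cons.IH
  proof safe
    fix e' assume *: "\<forall>x e'. (\<forall>i. i \<notin> set ns \<longrightarrow> e' i = (e(n := x)) i) \<longrightarrow> sat I e' \<phi>"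
      and "\<forall>i. i \<notin> set (n # ns) \<longrightarrow> e' i = e i"
    then have "\<forall>i. i \<notin> set ns \<longrightarrow> e' i = (e(n := e' n)) i" by auto
    with * show "sat I e' \<phi>" by blast
  next
    fix x e' assume *: "\<forall>e'. (\<forall>i. i \<notin> set (n # ns) \<longrightarrow> e' i = e i) \<longrightarrow> sat I e' \<phi>"
      and "\<forall>i. i \<notin> set ns \<longrightarrow> e' i = (e(n := x)) i"
    then have "\<forall>i. i \<notin> set (n # ns) \<longrightarrow> e' i = e i" by auto
    with * show "sat I e' \<phi>" by blast
  qed
qed

locale transfer =
  fixes U :: "('a, 'b) nonstandard_universe"
  assumes transfer_principle: "transfer_principle U"
    and inj_num: "inj (num U)"
begin

lemma denum_num [simp]: "denum U (num U z) = z"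
  by (simp add: inj_num)

text \<open>\<open>transfer_principle\<close> speaks only of environments
  \<open>elem_star U \<circ> e\<close> made of standard objects. The universal closure has no free
  variables, so after transfer its environment can be any internal one.\<close>

lemma transfer_forall:
  assumes "\<And>e. sat (\<lambda>R. R) e \<phi>"
  shows "sat (rel_star U) e \<phi>"
proof -
  obtain ns where ns: "set ns = formula_vars \<phi>"
    using finite_list[OF finite_formula_vars] by blast
  have "sat (\<lambda>R. R) (\<lambda>_. undefined) (foldr Forall ns \<phi>)"
    using assms by (simp add: sat_foldr_Forall)
  then have "sat (rel_star U) (elem_star U \<circ> (\<lambda>_. undefined)) (foldr Forall ns \<phi>)"
    using transfer_principle unfolding transfer_principle_def by blast
  then have "sat (rel_star U) (\<lambda>i. if i \<in> set ns then e i else (elem_star U \<circ> (\<lambda>_. undefined)) i) \<phi>"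
    unfolding sat_foldr_Forall by simp
  then show ?thesis
    by (subst sat_cong) (auto simp: ns)
qed

section \<open>Extended relations and connectives\<close>

text \<open>Both sides are atomic formulas over the same variables, equivalent for standard lists.
  Evaluating the transferred equivalence in the environment \<open>(!) zs\<close> reads variable
  \<open>i\<close> as the parameter at position \<open>i\<close>; the same device serves the lemmas
  on connectives.\<close>

lemma rel_star_reindex:
  assumes "set vs \<subseteq> {..<length zs}"
  shows "rel_star U R (map ((!) zs) vs) \<longleftrightarrow> rel_star U (\<lambda>l. R (map ((!) l) vs)) zs"
proof -
  let ?n = "length zs"
  let ?A = "Rel R vs" and ?B = "Rel (\<lambda>l. R (map ((!) l) vs)) [0..<?n]"
  have eq: "map ((!) (map e [0..<?n])) vs = map e vs" for e :: "nat \<Rightarrow> 'c"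
    using assms by auto
  have "sat (rel_star U) e (Neg (Conj ?A (Neg ?B)))" "sat (rel_star U) e (Neg (Conj ?B (Neg ?A)))" for e
    by (rule transfer_forall; simp add: eq)+
  from this[of "(!) zs"] show ?thesis
    by (auto simp: map_nth)
qed

lemma rel_star_mono:
  assumes "rel_star U R zs" and "\<And>l. length l = length zs \<Longrightarrow> R l \<Longrightarrow> S l"
  shows "rel_star U S zs"
proof -
  let ?n = "length zs"
  have "sat (rel_star U) e (Neg (Conj (Rel R [0..<?n]) (Neg (Rel S [0..<?n]))))" for e
    by (rule transfer_forall) (simp add: assms(2))
  from this[of "(!) zs"] show ?thesis
    using assms(1) by (simp add: map_nth)
qed

lemma rel_star_conj: "rel_star U (\<lambda>l. R l \<and> S l) zs \<longleftrightarrow> rel_star U R zs \<and> rel_star U S zs"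
proof -
  let ?v = "[0..<length zs]"
  have "sat (rel_star U) e (Neg (Conj (Conj (Rel R ?v) (Rel S ?v)) (Neg (Rel (\<lambda>l. R l \<and> S l) ?v))))" for e
    by (rule transfer_forall) simp
  from this[of "(!) zs"] have "rel_star U R zs \<and> rel_star U S zs \<Longrightarrow> rel_star U (\<lambda>l. R l \<and> S l) zs"
    by (simp add: map_nth)
  moreover have "rel_star U R zs" "rel_star U S zs" if "rel_star U (\<lambda>l. R l \<and> S l) zs"
    using that by (rule rel_star_mono; simp)+
  ultimately show ?thesis by blast
qed

lemma rel_star_not: "rel_star U (\<lambda>l. \<not> R l) zs \<longleftrightarrow> \<not> rel_star U R zs"
proof -
  let ?v = "[0..<length zs]"
  let ?A = "Rel R ?v" and ?B = "Rel (\<lambda>l. \<not> R l) ?v"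
  have "sat (rel_star U) e (Conj (Neg (Conj ?A ?B)) (Neg (Conj (Neg ?A) (Neg ?B))))" for e
    by (rule transfer_forall) simp
  from this[of "(!) zs"] show ?thesis
    by (auto simp: map_nth)
qed

section \<open>The filter of evaluations\<close>

text \<open>Puts several parameter lists over one common list, so that they can be compared inside a
  single relation.\<close>

lemma ex_indices:
  assumes "set xs \<subseteq> set zs"
  shows "\<exists>vs. set vs \<subseteq> {..<length zs} \<and> xs = map ((!) zs) vs"
proof -
  have "\<forall>x\<in>set xs. \<exists>i. i < length zs \<and> zs ! i = x"
    using assms by (metis in_set_conv_nth subsetD)
  then obtain f where "\<forall>x\<in>set xs. f x < length zs \<and> zs ! f x = x" by metis
  then show ?thesis by (intro exI[of _ "map f xs"]) (auto simp: map_idI)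
qed

text \<open>
  Over this filter, internal objects behave like germs of functions: a relation extends to internal
  objects iff it eventually holds between their values.
\<close>

definition F :: "('b \<Rightarrow> 'a) filter" where
  "F = (INF (R, xs) \<in> {(R, xs). rel_star U R xs}. principal {e. R (map e xs)})"

text \<open>The generating sets form a filter base: two true relations are joined into one on the
  concatenated parameters, and \<open>?T\<close> recovers them by slicing. The constantly true
  relation without parameters makes the base nonempty.\<close>

lemma eventually_F:
  "eventually P F \<longleftrightarrow> (\<exists>R xs. rel_star U R xs \<and> (\<forall>e. R (map e xs) \<longrightarrow> P e))"
proof -
  have "rel_star U (\<lambda>_. True) []"
    using transfer_forall[of "Rel (\<lambda>_. True) []"] by simp
  moreover have "\<exists>x\<in>{(R, xs). rel_star U R xs}. principal {e. fst x (map e (snd x))}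
        \<le> inf (principal {e. fst a (map e (snd a))}) (principal {e. fst b (map e (snd b))})"
    if "rel_star U (fst a) (snd a)" "rel_star U (fst b) (snd b)" for a b
  proof -
    obtain R xs S ys where ab: "a = (R, xs)" "b = (S, ys)" by fastforce
    let ?n = "length xs"
    let ?T = "\<lambda>l. R (map ((!) l) [0..<?n]) \<and> S (map ((!) l) [?n..<?n + length ys])"
    have 1: "map ((!) (xs' @ ys')) [0..<length xs'] = xs'"
       "map ((!) (xs' @ ys')) [length xs'..<length xs' + length ys'] = ys'" for xs' ys' :: "'c list"
      by (auto intro!: nth_equalityI simp: nth_append)
    have "rel_star U ?T (xs @ ys)"
      unfolding rel_star_conj using that ab
      by (subst (1 2) rel_star_reindex[symmetric]) (auto simp: 1)
    moreover have "?T (map e (xs @ ys)) \<longleftrightarrow> R (map e xs) \<and> S (map e ys)" for e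
      using 1[of "map e xs" "map e ys"] by simp
    ultimately show ?thesis
      by (intro bexI[of _ "(?T, xs @ ys)"]) (auto simp: ab)
  qed
  ultimately show ?thesis
    unfolding F_def case_prod_unfold
    by (subst eventually_INF_base) (auto simp: eventually_principal)
qed

text \<open>Los theorem for \<open>F\<close>. The hard direction starts from a relation on other
  parameters \<open>ys\<close> that forces \<open>R\<close>, and both lists are moved over a common
  \<open>zs\<close>.\<close>

lemma rel_star_iff_eventually: "rel_star U R xs \<longleftrightarrow> (\<forall>\<^sub>F e in F. R (map e xs))"
proof
  assume "\<forall>\<^sub>F e in F. R (map e xs)"
  then obtain S ys where S: "rel_star U S ys" "\<And>e. S (map e ys) \<Longrightarrow> R (map e xs)"
    unfolding eventually_F by blast
  \<comment> \<open>Without repetitions every list of standard values for \<open>zs\<close> comes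
    from an evaluation, so a statement about all \<open>e\<close> becomes one about all lists
    \<open>l\<close>.\<close>
  define zs where "zs = remdups (xs @ ys)"
  have zs: "set xs \<subseteq> set zs" "set ys \<subseteq> set zs" by (auto simp: zs_def)
  obtain vs where vs: "set vs \<subseteq> {..<length zs}" "xs = map ((!) zs) vs"
    using ex_indices[OF zs(1)] by blast
  obtain ws where ws: "set ws \<subseteq> {..<length zs}" "ys = map ((!) zs) ws"
    using ex_indices[OF zs(2)] by blast
  have "rel_star U (\<lambda>l. S (map ((!) l) ws)) zs"
    using S(1) by (simp only: ws(2) rel_star_reindex[OF ws(1)])
  then have "rel_star U (\<lambda>l. R (map ((!) l) vs)) zs"
  proof (rule rel_star_mono)
    fix l :: "'a list" assume l: "length l = length zs" "S (map ((!) l) ws)"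
    have "distinct zs" by (simp add: zs_def)
    define e where "e = (\<lambda>x. l ! (THE i. i < length zs \<and> zs ! i = x))"
    have e: "e (zs ! i) = l ! i" if "i < length zs" for i
    proof -
      have "(THE j. j < length zs \<and> zs ! j = zs ! i) = i"
        using that \<open>distinct zs\<close> by (auto simp: nth_eq_iff_index_eq)
      then show ?thesis by (simp add: e_def)
    qed
    have "map e ys = map ((!) l) ws" "map e xs = map ((!) l) vs"
      using e vs ws by auto
    then show "R (map ((!) l) vs)"
      using S(2)[of e] l by simp
  qed
  then show "rel_star U R xs"
    by (simp only: vs(2) rel_star_reindex[OF vs(1)])
qed (auto simp: eventually_F)

text \<open>Ultrafilter property, for sets given by a relation on the values of finitely many
  internal objects. Later lemmas therefore carry an explicit parameter list
  \<open>ps\<close>.\<close>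

lemma eventually_not_F:
  "(\<forall>\<^sub>F e in F. \<not> R (map e xs)) \<longleftrightarrow> \<not> (\<forall>\<^sub>F e in F. R (map e xs))"
  using rel_star_not[of R xs] by (simp add: rel_star_iff_eventually)

lemma F_neq_bot: "F \<noteq> bot"
  using eventually_not_F[of "\<lambda>_. False" "[]"] by (simp add: trivial_limit_def)

text \<open>\<open>Equal\<close> is a logical symbol; comparing it with the relation symbol for
  standard equality lets identities of internal objects be checked at evaluations.\<close>

lemma eq_iff_eventually: "x = y \<longleftrightarrow> (\<forall>\<^sub>F e in F. e x = e y)"
proof -
  let ?A = "Equal 0 1" and ?B = "Rel (\<lambda>l. l ! 0 = l ! 1) [0, 1]"
  have "sat (rel_star U) e (Conj (Neg (Conj ?A (Neg ?B))) (Neg (Conj (Neg ?A) ?B)))" for e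
    by (rule transfer_forall) simp
  from this[of "(!) [x, y]"] have "x = y \<longleftrightarrow> rel_star U (\<lambda>l. l ! 0 = l ! 1) [x, y]"
    by auto
  then show ?thesis
    by (simp add: rel_star_iff_eventually)
qed

lemma eventually_elem_star: "\<forall>\<^sub>F e in F. e (elem_star U a) = a"
proof -
  have "sat (\<lambda>R. R) (\<lambda>_. a) (Rel (\<lambda>l. l ! 0 = a) [0])" by simp
  then have "sat (rel_star U) (elem_star U \<circ> (\<lambda>_. a)) (Rel (\<lambda>l. l ! 0 = a) [0])"
    using transfer_principle unfolding transfer_principle_def by blast
  then show ?thesis
    by (simp add: rel_star_iff_eventually)
qed

text \<open>Justifies the definite description in \<open>fun_star\<close>: a value exists by
  transfer of totality, and two values coincide eventually, hence are equal.\<close>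

lemma eventually_fun_star: "\<forall>\<^sub>F e in F. e (fun_star U f xs) = f (map e xs)"
proof -
  let ?R = "\<lambda>l. hd l = f (tl l)"
  have "sat (rel_star U) e (Neg (Forall 0 (Neg (Rel ?R [0..<Suc (length xs)]))))" for e
    by (rule transfer_forall)
      (auto simp: upt_rec[of 0 "Suc _"] simp del: upt_Suc intro!: exI[of _ "f (map _ [Suc 0..<Suc (length xs)])"])
  \<comment> \<open>Variable 0 is bound, so the placeholder \<open>undefined\<close> gives way to
    the witness.\<close>
  from this[of "(!) (undefined # xs)"]
  obtain y where "rel_star U ?R (map (((!) (undefined # xs))(0 := y)) [0..<Suc (length xs)])"
    by auto
  moreover have "map (((!) (undefined # xs))(0 := y)) [0..<Suc (length xs)] = y # xs"
    by (intro nth_equalityI) (auto simp: nth_Cons simp del: upt_Suc split: nat.split)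
  ultimately have y: "rel_star U ?R (y # xs)" by (simp del: upt_Suc)
  have "fun_star U f xs = y"
    unfolding fun_star_def
  proof (rule the_equality, rule y)
    fix z assume "rel_star U ?R (z # xs)"
    with y show "z = y"
      unfolding rel_star_iff_eventually
      by (subst eq_iff_eventually) (auto elim: eventually_elim2)
  qed
  with y show ?thesis
    by (simp add: rel_star_iff_eventually)
qed

section \<open>Quantifiers over internal objects and limits along the filter\<close>

text \<open>\<open>g\<close> is a Skolem function of the parameter values; its extension at
  \<open>ps\<close> is an internal witness. Choosing a point separately for each \<open>e\<close>
  would not yield an internal object.\<close>

lemma eventually_ex:
  assumes "\<forall>\<^sub>F e in F. \<exists>a. Q a (map e ps)"
  shows "\<exists>y. \<forall>\<^sub>F e in F. Q (e y) (map e ps)"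
proof -
  define g where "g = (\<lambda>l. SOME a. Q a l)"
  have g: "Q (g l) l" if "\<exists>a. Q a l" for l
    using someI_ex[of "\<lambda>a. Q a l"] that by (simp add: g_def)
  have "\<forall>\<^sub>F e in F. Q (e (fun_star U g ps)) (map e ps)"
    using assms eventually_fun_star[of g ps] by (rule eventually_elim2) (simp add: g)
  then show ?thesis by (rule exI)
qed

text \<open>Otherwise the failure would hold eventually, as \<open>F\<close> decides it, and a
  Skolem function would produce an internal counterexample \<open>y\<close>.\<close>

lemma eventually_all:
  assumes "\<And>y. \<forall>\<^sub>F e in F. Q (e y) (map e ps)"
  shows "\<forall>\<^sub>F e in F. \<forall>a. Q a (map e ps)"
proof (rule ccontr)
  assume "\<not> ?thesis"
  then have "\<forall>\<^sub>F e in F. \<exists>a. \<not> Q a (map e ps)"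
    using eventually_not_F[of "\<lambda>l. \<forall>a. Q a l" ps] by simp
  then obtain y where "\<forall>\<^sub>F e in F. \<not> Q (e y) (map e ps)"
    using eventually_ex[of "\<lambda>a l. \<not> Q a l"] by blast
  with assms[of y] have "\<forall>\<^sub>F e in F. False" by eventually_elim simp
  then show False using F_neq_bot by (simp add: trivial_limit_def)
qed

text \<open>
  The images of \<open>F\<close> under internal functions are ultrafilters, so compactness provides standard
  parts.
\<close>

lemma internal_tendsto:
  fixes f :: "'a list \<Rightarrow> complex"
  assumes "\<forall>\<^sub>F e in F. cmod (f (map e ps)) \<le> B"
  shows "\<exists>w. ((\<lambda>e. f (map e ps)) \<longlongrightarrow> w) F"
proof -
  let ?G = "filtermap (\<lambda>e. f (map e ps)) F"
  have "\<forall>\<^sub>F z in ?G. z \<in> cball 0 B"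
    using assms by (simp add: eventually_filtermap)
  moreover have "?G \<noteq> bot" by (simp add: F_neq_bot filtermap_bot_iff)
  ultimately obtain w where w: "inf (nhds w) ?G \<noteq> bot"
    using compact_cball[of "0::complex" B] unfolding compact_filter by meson
  have "((\<lambda>e. f (map e ps)) \<longlongrightarrow> w) F"
  proof (rule topological_tendstoI, rule ccontr)
    fix S assume S: "open S" "w \<in> S" "\<not> (\<forall>\<^sub>F e in F. f (map e ps) \<in> S)"
    then have "\<forall>\<^sub>F e in F. f (map e ps) \<notin> S"
      using eventually_not_F[of "\<lambda>l. f l \<in> S" ps] by simp
    then have "\<forall>\<^sub>F z in ?G. z \<notin> S" by (simp add: eventually_filtermap)
    moreover have "\<forall>\<^sub>F z in nhds w. z \<in> S" using S eventually_nhds_in_open by blast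
    ultimately have "\<forall>\<^sub>F z in inf (nhds w) ?G. False"
      unfolding eventually_inf
      by (rule_tac exI[of _ "\<lambda>z. z \<in> S"], rule_tac exI[of _ "\<lambda>z. z \<notin> S"]) simp
    with w show False by (simp add: trivial_limit_def)
  qed
  then show ?thesis by blast
qed

end

section \<open>Hypercomplex numbers and saturation\<close>

context transfer
begin

section \<open>Order, finiteness and standard parts along the filter\<close>

lemma hr_less_hc_abs_iff:
  "hr_less U (hc_abs U z) (cnum U (of_real r)) \<longleftrightarrow> (\<forall>\<^sub>F e in F. cmod (denum U (e z)) < r)"
proof -
  have 1: "\<forall>\<^sub>F e in F. e (hc_abs U z) = num U (of_real (cmod (denum U (e z))))"
    unfolding hc_abs_def hc_lift1_def
    using eventually_fun_star[of "\<lambda>l. num U (of_real (cmod (denum U (l ! 0))))" "[z]"] by simp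
  have 2: "\<forall>\<^sub>F e in F. e (cnum U (of_real r)) = num U (of_real r)"
    unfolding cnum_def by (rule eventually_elem_star)
  have "\<forall>\<^sub>F e in F. (\<exists>x y :: real. map e [hc_abs U z, cnum U (of_real r)] ! 0 = num U (of_real x) \<and>
      map e [hc_abs U z, cnum U (of_real r)] ! 1 = num U (of_real y) \<and> x < y) \<longleftrightarrow> cmod (denum U (e z)) < r"
    using 1 2 by (rule eventually_elim2) (simp add: inj_num inj_eq del: of_real_eq_iff, simp)
  then show ?thesis
    unfolding hr_less_def rel_star_iff_eventually by (rule eventually_subst)
qed

lemma hr_le_iff:
  "hr_le U r s \<longleftrightarrow> (\<forall>\<^sub>F e in F. \<exists>x y. e r = num U (of_real x) \<and> e s = num U (of_real y) \<and> x \<le> y)"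
  unfolding hr_le_def rel_star_iff_eventually by simp

lemma eventually_hc_lift1: "\<forall>\<^sub>F e in F. e (hc_lift1 U f z) = num U (f (denum U (e z)))"
  unfolding hc_lift1_def
  using eventually_fun_star[of "\<lambda>l. num U (f (denum U (l ! 0)))" "[z]"] by simp

lemma eventually_hc_lift2:
  "\<forall>\<^sub>F e in F. e (hc_lift2 U f z w) = num U (f (denum U (e z)) (denum U (e w)))"
  unfolding hc_lift2_def
  using eventually_fun_star[of "\<lambda>l. num U (f (denum U (l ! 0)) (denum U (l ! 1)))" "[z, w]"] by simp

lemma eventually_cnum: "\<forall>\<^sub>F e in F. e (cnum U z) = num U z"
  unfolding cnum_def by (rule eventually_elem_star)

lemma hc_finite_iff: "hc_finite U z \<longleftrightarrow> (\<exists>B. \<forall>\<^sub>F e in F. cmod (denum U (e z)) \<le> B)"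
proof -
  have "hc_finite U z \<longleftrightarrow> (\<exists>n::nat. \<forall>\<^sub>F e in F. cmod (denum U (e z)) < n)"
    unfolding hc_finite_def hr_less_hc_abs_iff[symmetric] by simp
  also have "\<dots> \<longleftrightarrow> (\<exists>B. \<forall>\<^sub>F e in F. cmod (denum U (e z)) \<le> B)"
  proof
    assume "\<exists>n::nat. \<forall>\<^sub>F e in F. cmod (denum U (e z)) < n"
    then obtain n :: nat where "\<forall>\<^sub>F e in F. cmod (denum U (e z)) < n" by blast
    then have "\<forall>\<^sub>F e in F. cmod (denum U (e z)) \<le> n" by (rule eventually_mono) simp
    then show "\<exists>B. \<forall>\<^sub>F e in F. cmod (denum U (e z)) \<le> B" by blast
  next
    assume "\<exists>B. \<forall>\<^sub>F e in F. cmod (denum U (e z)) \<le> B"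
    then obtain B where B: "\<forall>\<^sub>F e in F. cmod (denum U (e z)) \<le> B" by blast
    obtain n :: nat where n: "B < n" using reals_Archimedean2 by blast
    from B have "\<forall>\<^sub>F e in F. cmod (denum U (e z)) < n" by (rule eventually_mono) (use n in linarith)
    then show "\<exists>n::nat. \<forall>\<^sub>F e in F. cmod (denum U (e z)) < n" by blast
  qed
  finally show ?thesis .
qed

lemma hc_approx_iff:
  "hc_approx U z w \<longleftrightarrow> ((\<lambda>e. denum U (e z) - denum U (e w)) \<longlongrightarrow> 0) F"
proof -
  let ?d = "\<lambda>e. denum U (e z) - denum U (e w)"
  have "hc_approx U z w \<longleftrightarrow> (\<forall>n::nat. n \<ge> 1 \<longrightarrow> (\<forall>\<^sub>F e in F. cmod (?d e) < 1 / real n))"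
  proof -
    have *: "hr_less U (hc_abs U (hc_lift2 U (-) z w)) (cnum U (1 / of_nat n)) \<longleftrightarrow>
        (\<forall>\<^sub>F e in F. cmod (?d e) < 1 / real n)" for n :: nat
    proof -
      have "hr_less U (hc_abs U (hc_lift2 U (-) z w)) (cnum U (1 / of_nat n)) \<longleftrightarrow>
         (\<forall>\<^sub>F e in F. cmod (denum U (e (hc_lift2 U (-) z w))) < 1 / real n)"
        using hr_less_hc_abs_iff[of "hc_lift2 U (-) z w" "1 / real n"] by simp
      also have "\<dots> \<longleftrightarrow> (\<forall>\<^sub>F e in F. cmod (?d e) < 1 / real n)"
        by (rule eventually_subst, rule eventually_mono[OF eventually_hc_lift2[of "(-)" z w]]) simp
      finally show ?thesis .
    qed
    show ?thesis unfolding hc_approx_def * ..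
  qed
  also have "\<dots> \<longleftrightarrow> (?d \<longlongrightarrow> 0) F"
  proof
    assume *: "\<forall>n::nat. n \<ge> 1 \<longrightarrow> (\<forall>\<^sub>F e in F. cmod (?d e) < 1 / real n)"
    show "(?d \<longlongrightarrow> 0) F"
      unfolding tendsto_iff dist_norm
    proof (intro allI impI)
      fix r :: real assume "r > 0"
      then obtain n :: nat where n: "1 / Suc n < r"
        by (meson nat_approx_posE)
      have "\<forall>\<^sub>F e in F. cmod (?d e) < 1 / Suc n" using *[rule_format, of "Suc n"] by simp
      then show "\<forall>\<^sub>F e in F. cmod (?d e - 0) < r" by (rule eventually_mono) (use n in simp)
    qed
  next
    assume *: "(?d \<longlongrightarrow> 0) F"
    show "\<forall>n::nat. n \<ge> 1 \<longrightarrow> (\<forall>\<^sub>F e in F. cmod (?d e) < 1 / real n)"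
    proof (intro allI impI)
      fix n :: nat assume "n \<ge> 1"
      then show "\<forall>\<^sub>F e in F. cmod (?d e) < 1 / real n"
        using tendstoD[OF *, of "1 / real n"] by simp
    qed
  qed
  finally show ?thesis .
qed

lemma hc_approx_cnum_iff:
  "hc_approx U z (cnum U w) \<longleftrightarrow> ((\<lambda>e. denum U (e z)) \<longlongrightarrow> w) F"
proof -
  have "\<forall>\<^sub>F e in F. denum U (e z) - denum U (e (cnum U w)) = denum U (e z) - w"
    using eventually_cnum[of w] by (rule eventually_mono) simp
  then have "((\<lambda>e. denum U (e z) - denum U (e (cnum U w))) \<longlongrightarrow> 0) F \<longleftrightarrow>
      ((\<lambda>e. denum U (e z) - w) \<longlongrightarrow> 0) F"
    by (rule tendsto_cong)
  then show ?thesis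
    unfolding hc_approx_iff using Lim_null[of "\<lambda>e. denum U (e z)" w F] by simp
qed

lemma standard_part_eqI: "((\<lambda>e. denum U (e z)) \<longlongrightarrow> w) F \<Longrightarrow> standard_part U z = w"
  unfolding standard_part_def hc_approx_cnum_iff
  by (rule the_equality) (auto intro: tendsto_unique[OF F_neq_bot])

end

locale nonstandard =
  fixes U :: "('a, 'b) nonstandard_universe" and \<kappa> :: "'k rel"
  assumes nonstandard_universe: "nonstandard_universe U \<kappa>"

sublocale nonstandard \<subseteq> transfer
  by unfold_locales (use nonstandard_universe in \<open>simp_all add: nonstandard_universe_def\<close>)

context nonstandard
begin

text \<open>Uncountability of \<kappa> makes the countable family \<open>range A\<close> admissible.
  Solving initial segments is enough, since each finite subfamily lies in one, and every condition
  may have its own parameters \<open>ps i\<close>.\<close>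

lemma saturation:
  fixes Q :: "nat \<Rightarrow> 'a \<Rightarrow> 'a list \<Rightarrow> bool"
  assumes "\<And>n. \<exists>y. \<forall>i\<le>n. \<forall>\<^sub>F e in F. Q i (e y) (map e (ps i))"
  shows "\<exists>y. \<forall>i. \<forall>\<^sub>F e in F. Q i (e y) (map e (ps i))"
proof -
  define A where "A i = {y. rel_star U (\<lambda>l. Q i (hd l) (tl l)) (y # ps i)}" for i
  have A: "y \<in> A i \<longleftrightarrow> (\<forall>\<^sub>F e in F. Q i (e y) (map e (ps i)))" for y i
    by (simp add: A_def rel_star_iff_eventually)
  have "countable (range A)" by simp
  then have "|range A| \<le>o natLeq"
    by (simp add: countable_card_le_natLeq)
  moreover have "natLeq <o \<kappa>" "saturated U \<kappa>"
    using nonstandard_universe by (simp_all add: nonstandard_universe_def)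
  ultimately have "|range A| <o \<kappa>" by (meson ordLeq_ordLess_trans)
  moreover have "internal_set U B" if "B \<in> range A" for B
    using that unfolding internal_set_def A_def by blast
  moreover have "\<Inter>G \<noteq> {}" if "G \<subseteq> range A" "finite G" for G
  proof -
    from finite_subset_image[OF that(2,1)]
    obtain I where I: "finite I" "G = A ` I" by blast
    \<comment> \<open>For empty \<open>I\<close> the value of \<open>Max I\<close> is arbitrary, but
      then any \<open>y\<close> will do.\<close>
    obtain y where "\<forall>i\<le>Max I. \<forall>\<^sub>F e in F. Q i (e y) (map e (ps i))"
      using assms by blast
    then have "y \<in> \<Inter>G" using I(1) by (auto simp: I(2) A)
    then show ?thesis by blast
  qed
  moreover note spec[OF \<open>saturated U \<kappa>\<close>[unfolded saturated_def], of "range A"]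
  ultimately have "\<Inter>(range A) \<noteq> {}" by simp
  then obtain y where "y \<in> \<Inter>(range A)" by (meson ex_in_conv)
  then have "\<forall>i. y \<in> A i" by simp
  then show ?thesis unfolding A by (rule exI)
qed

end

section \<open>Hilbert spaces and projections\<close>

lemma complex_ring_simps [simp]:
  "carrier complex_ring = UNIV" "\<zero>\<^bsub>complex_ring\<^esub> = 0" "\<one>\<^bsub>complex_ring\<^esub> = 1"
  "x \<oplus>\<^bsub>complex_ring\<^esub> y = x + y" "x \<otimes>\<^bsub>complex_ring\<^esub> y = x * y"
  by (simp_all add: complex_ring_def)

locale hilbert =
  fixes H :: "(complex, 'v) inner_space" (structure)
  assumes hilbert: "complex_hilbert_space H"

sublocale hilbert \<subseteq> module complex_ring H
  using hilbert by (simp add: complex_hilbert_space_def)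

context hilbert
begin

section \<open>Inner product, norm and distance\<close>

lemma smult_in_carrier [simp, intro]: "x \<in> carrier H \<Longrightarrow> c \<odot> x \<in> carrier H"
  by (rule smult_closed) simp_all

lemma smult_zero_left [simp]: "x \<in> carrier H \<Longrightarrow> 0 \<odot> x = \<zero>"
  using smult_l_null by simp

lemma minus_zero_eq [simp]: "\<ominus> \<zero> = \<zero>"
  by (rule minus_equality) simp_all

text \<open>\<open>\<ominus>\<close> is a definite description in the additive group; as a scalar
  multiple it is handled by linearity of operators and by transfer.\<close>

lemma minus_eq_smult:
  assumes "z \<in> carrier H"
  shows "\<ominus> z = (-1) \<odot> z"
proof -
  have "z \<oplus> (-1) \<odot> z = (1 + -1) \<odot> z"
    using assms smult_l_distr[of 1 "-1" z] smult_one[of z] by (simp del: smult_one)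
  then have "z \<oplus> (-1) \<odot> z = \<zero>" using assms by simp
  then show ?thesis using assms by (simp add: minus_equality a_comm)
qed

lemma ip_add_left:
  "\<lbrakk>x \<in> carrier H; y \<in> carrier H; z \<in> carrier H\<rbrakk> \<Longrightarrow> ip H (x \<oplus> y) z = ip H x z + ip H y z"
  and ip_smult_left: "\<lbrakk>x \<in> carrier H; y \<in> carrier H\<rbrakk> \<Longrightarrow> ip H (c \<odot> x) y = c * ip H x y"
  and ip_cnj: "\<lbrakk>x \<in> carrier H; y \<in> carrier H\<rbrakk> \<Longrightarrow> ip H y x = cnj (ip H x y)"
  and ip_nonneg: "x \<in> carrier H \<Longrightarrow> 0 \<le> Re (ip H x x)"
  and ip_eq_zero: "\<lbrakk>x \<in> carrier H; ip H x x = 0\<rbrakk> \<Longrightarrow> x = \<zero>"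
  using hilbert unfolding complex_hilbert_space_def by blast+

lemma ip_zero_left [simp]: "y \<in> carrier H \<Longrightarrow> ip H \<zero> y = 0"
  using ip_smult_left[of \<zero> y 0] by simp

lemma ip_zero_right [simp]: "y \<in> carrier H \<Longrightarrow> ip H y \<zero> = 0"
  using ip_cnj[of \<zero> y] by simp

lemma ip_minus_left [simp]:
  assumes "x \<in> carrier H" "y \<in> carrier H"
  shows "ip H (\<ominus> x) y = - ip H x y"
proof -
  have "ip H (x \<oplus> \<ominus> x) y = 0" using assms by (simp add: r_neg)
  then show ?thesis
    using assms by (simp add: ip_add_left eq_neg_iff_add_eq_0 add.commute)
qed

lemma ip_diff_left:
  "\<lbrakk>x \<in> carrier H; y \<in> carrier H; z \<in> carrier H\<rbrakk> \<Longrightarrow> ip H (x \<ominus> y) z = ip H x z - ip H y z"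
  by (simp add: a_minus_def ip_add_left)

lemma ip_diff_right:
  "\<lbrakk>x \<in> carrier H; y \<in> carrier H; z \<in> carrier H\<rbrakk> \<Longrightarrow> ip H z (x \<ominus> y) = ip H z x - ip H z y"
  using ip_cnj[of "x \<ominus> y" z] ip_cnj[of x z] ip_cnj[of y z] by (simp add: ip_diff_left)

lemma ip_add_right:
  "\<lbrakk>x \<in> carrier H; y \<in> carrier H; z \<in> carrier H\<rbrakk> \<Longrightarrow> ip H z (x \<oplus> y) = ip H z x + ip H z y"
  using ip_cnj[of "x \<oplus> y" z] ip_cnj[of x z] ip_cnj[of y z] by (simp add: ip_add_left)

lemma ip_smult_right:
  "\<lbrakk>x \<in> carrier H; y \<in> carrier H\<rbrakk> \<Longrightarrow> ip H y (c \<odot> x) = cnj c * ip H y x"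
  using ip_cnj[of "c \<odot> x" y] ip_cnj[of x y] by (simp add: ip_smult_left)

lemma hnorm_power2: "x \<in> carrier H \<Longrightarrow> (hnorm H x)\<^sup>2 = Re (ip H x x)"
  by (simp add: hnorm_def ip_nonneg)

lemma ip_self: "x \<in> carrier H \<Longrightarrow> ip H x x = of_real ((hnorm H x)\<^sup>2)"
  using ip_cnj[of x x] by (simp add: hnorm_power2 complex_eq_iff)

lemma hnorm_nonneg [simp]: "x \<in> carrier H \<Longrightarrow> 0 \<le> hnorm H x"
  by (simp add: hnorm_def ip_nonneg)

lemma hnorm_zero [simp]: "hnorm H \<zero> = 0"
  by (simp add: hnorm_def)

lemma hnorm_eq_zero: "x \<in> carrier H \<Longrightarrow> hnorm H x = 0 \<Longrightarrow> x = \<zero>"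
  using ip_self ip_eq_zero by simp

lemma hnorm_smult:
  assumes "x \<in> carrier H"
  shows "hnorm H (c \<odot> x) = cmod c * hnorm H x"
proof -
  have "Re (ip H (c \<odot> x) (c \<odot> x)) = (cmod c)\<^sup>2 * (hnorm H x)\<^sup>2"
  proof -
    have "ip H (c \<odot> x) (c \<odot> x) = (c * cnj c) * of_real ((hnorm H x)\<^sup>2)"
      using assms by (simp add: ip_smult_left ip_smult_right ip_self[of x])
    also have "\<dots> = of_real ((cmod c)\<^sup>2 * (hnorm H x)\<^sup>2)"
      by (simp only: complex_norm_square[symmetric] of_real_mult)
    finally show ?thesis by (simp only: Re_complex_of_real)
  qed
  then show ?thesis
    using assms by (simp add: hnorm_def[of H "c \<odot> x"] real_sqrt_mult)
qed

lemma Cauchy_Schwarz: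
  assumes "x \<in> carrier H" "y \<in> carrier H"
  shows "cmod (ip H x y) \<le> hnorm H x * hnorm H y"
proof (cases "hnorm H y = 0")
  case True
  then show ?thesis using hnorm_eq_zero[of y] assms by simp
next
  case False
  \<comment> \<open>Coefficient of the orthogonal projection of \<open>x\<close> onto
    \<open>y\<close>; the inequality is the positivity of the remainder \<open>?z\<close>.\<close>
  define c where "c = ip H x y / of_real ((hnorm H y)\<^sup>2)"
  let ?z = "x \<ominus> c \<odot> y"
  have y: "(hnorm H y)\<^sup>2 > 0" using False by simp
  have "ip H ?z ?z = ip H x x - cnj c * ip H x y - c * ip H y x + c * cnj c * ip H y y"
    using assms by (simp add: ip_diff_left ip_diff_right ip_smult_left ip_smult_right algebra_simps)
  also have "\<dots> = ip H x x - cnj c * ip H x y"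
  proof -
    have "cnj c * ip H y y = ip H y x"
    using False by (simp add: c_def ip_cnj[OF assms] ip_self[OF assms(2)])
    then show ?thesis by (simp add: mult.assoc)
  qed
  also have "cnj c * ip H x y = of_real ((cmod (ip H x y))\<^sup>2 / (hnorm H y)\<^sup>2)"
    by (simp add: c_def mult.commute[of "cnj _"] complex_norm_square[symmetric])
  finally have "ip H ?z ?z = of_real ((hnorm H x)\<^sup>2 - (cmod (ip H x y))\<^sup>2 / (hnorm H y)\<^sup>2)"
    using assms by (simp add: ip_self)
  then have "0 \<le> (hnorm H x)\<^sup>2 - (cmod (ip H x y))\<^sup>2 / (hnorm H y)\<^sup>2"
    using ip_nonneg[of ?z] assms by (simp del: of_real_diff)
  then have "(cmod (ip H x y))\<^sup>2 \<le> (hnorm H x * hnorm H y)\<^sup>2"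
    using y by (simp add: field_simps power_mult_distrib)
  then show ?thesis
    using assms by (simp add: power2_le_iff_abs_le)
qed

lemma hnorm_triangle:
  assumes "x \<in> carrier H" "y \<in> carrier H"
  shows "hnorm H (x \<oplus> y) \<le> hnorm H x + hnorm H y"
proof -
  have "Re (ip H x y) \<le> hnorm H x * hnorm H y" "Re (ip H y x) \<le> hnorm H x * hnorm H y"
    using Cauchy_Schwarz[OF assms] Cauchy_Schwarz[OF assms(2,1)] complex_Re_le_cmod
    by (smt (verit) mult.commute)+
  then have "(hnorm H (x \<oplus> y))\<^sup>2 \<le> (hnorm H x + hnorm H y)\<^sup>2"
    using assms by (simp add: hnorm_power2 ip_add_left ip_add_right power2_sum)
  then show ?thesis
    using assms by (simp add: power2_le_iff_abs_le)
qed

lemma hdist_nonneg [simp]: "x \<in> carrier H \<Longrightarrow> y \<in> carrier H \<Longrightarrow> 0 \<le> hdist H x y"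
  by (simp add: hdist_def)

lemma hdist_self [simp]: "x \<in> carrier H \<Longrightarrow> hdist H x x = 0"
  by (simp add: hdist_def a_minus_def r_neg)

lemma hdist_zero [simp]: "x \<in> carrier H \<Longrightarrow> hdist H x \<zero> = hnorm H x"
  by (simp add: hdist_def a_minus_def)

lemma hdist_commute:
  assumes "x \<in> carrier H" "y \<in> carrier H"
  shows "hdist H x y = hdist H y x"
  using assms by (simp add: hdist_def hnorm_def ip_diff_left ip_diff_right)

lemma hdist_triangle:
  assumes "x \<in> carrier H" "y \<in> carrier H" "z \<in> carrier H"
  shows "hdist H x z \<le> hdist H x y + hdist H y z"
proof -
  have "x \<ominus> z = (x \<ominus> y) \<oplus> (y \<ominus> z)"
    using assms by (simp add: a_minus_def a_assoc r_neg1)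
  then show ?thesis
    unfolding hdist_def using assms hnorm_triangle by simp
qed

lemma hnorm_le_hdist:
  "x \<in> carrier H \<Longrightarrow> y \<in> carrier H \<Longrightarrow> hnorm H x \<le> hdist H x y + hnorm H y"
  using hdist_triangle[of x y \<zero>] by simp

lemma hdist_add:
  assumes "x \<in> carrier H" "y \<in> carrier H" "x' \<in> carrier H" "y' \<in> carrier H"
  shows "hdist H (x \<oplus> y) (x' \<oplus> y') \<le> hdist H x x' + hdist H y y'"
proof -
  have "(x \<oplus> y) \<ominus> (x' \<oplus> y') = (x \<ominus> x') \<oplus> (y \<ominus> y')"
    using assms by (simp add: a_minus_def minus_add a_ac)
  then show ?thesis
    unfolding hdist_def using assms hnorm_triangle by simp
qed

lemma hdist_smult:
  assumes "x \<in> carrier H" "y \<in> carrier H"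
  shows "hdist H (c \<odot> x) (c \<odot> y) = cmod c * hdist H x y"
proof -
  have "c \<odot> x \<ominus> c \<odot> y = c \<odot> (x \<ominus> y)"
    using assms by (simp add: a_minus_def smult_r_distr smult_r_minus)
  then show ?thesis
    unfolding hdist_def using assms hnorm_smult by simp
qed

section \<open>Bounded operators and the operator norm\<close>

lemma bounded_opsD:
  assumes "T \<in> bounded_ops H"
  shows "x \<in> carrier H \<Longrightarrow> T x \<in> carrier H"
    and "\<lbrakk>x \<in> carrier H; y \<in> carrier H\<rbrakk> \<Longrightarrow> T (x \<oplus> y) = T x \<oplus> T y"
    and "x \<in> carrier H \<Longrightarrow> T (c \<odot> x) = c \<odot> T x"
    and "\<exists>B. \<forall>x\<in>carrier H. hnorm H (T x) \<le> B * hnorm H x"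
  using assms unfolding bounded_ops_def by (auto simp: PiE_iff)

lemma bounded_op_diff:
  assumes "T \<in> bounded_ops H" "x \<in> carrier H" "y \<in> carrier H"
  shows "T (x \<ominus> y) = T x \<ominus> T y"
proof -
  show ?thesis
    using assms bounded_opsD(1,2,3)[OF assms(1)] by (simp add: a_minus_def minus_eq_smult)
qed

lemma opnorm_bound:
  assumes "T \<in> bounded_ops H" "x \<in> carrier H"
  shows "hnorm H (T x) \<le> opnorm H T * hnorm H x"
proof -
  let ?S = "{B. 0 \<le> B \<and> (\<forall>x\<in>carrier H. hnorm H (T x) \<le> B * hnorm H x)}"
  obtain B where B: "\<forall>x\<in>carrier H. hnorm H (T x) \<le> B * hnorm H x"
    using bounded_opsD(4)[OF assms(1)] by blast
  \<comment> \<open>\<open>bounded_ops\<close> does not ask for a nonnegative bound, the set under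
    \<open>Inf\<close> does; the absolute value shows that this set is nonempty.\<close>
  have "\<forall>x\<in>carrier H. hnorm H (T x) \<le> \<bar>B\<bar> * hnorm H x"
  proof
    fix x assume "x \<in> carrier H"
    then show "hnorm H (T x) \<le> \<bar>B\<bar> * hnorm H x"
      using B mult_right_mono[of B "\<bar>B\<bar>" "hnorm H x"] by force
  qed
  then have ne: "\<bar>B\<bar> \<in> ?S" by simp
  show ?thesis
  proof (cases "hnorm H x = 0")
    case True
    then show ?thesis using B assms(2) by force
  next
    case False
    then have pos: "hnorm H x > 0" using assms(2) by (simp add: less_le)
    have "hnorm H (T x) / hnorm H x \<le> Inf ?S"
    proof (rule cInf_greatest)
      show "?S \<noteq> {}" using ne by blast
    qed (use assms(2) pos in \<open>auto simp: field_simps\<close>)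
    then show ?thesis
      unfolding opnorm_def using pos by (simp add: field_simps)
  qed
qed

lemma opnorm_nonneg:
  assumes "T \<in> bounded_ops H"
  shows "0 \<le> opnorm H T"
proof -
  obtain B where B: "\<forall>x\<in>carrier H. hnorm H (T x) \<le> B * hnorm H x"
    using bounded_opsD(4)[OF assms(1)] by blast
  have "\<forall>x\<in>carrier H. hnorm H (T x) \<le> \<bar>B\<bar> * hnorm H x"
  proof
    fix x assume "x \<in> carrier H"
    then show "hnorm H (T x) \<le> \<bar>B\<bar> * hnorm H x"
      using B mult_right_mono[of B "\<bar>B\<bar>" "hnorm H x"] by force
  qed
  then show ?thesis
    unfolding opnorm_def by (intro cInf_greatest) (auto intro!: exI[of _ "\<bar>B\<bar>"])
qed

lemma opnorm_le:
  assumes "0 \<le> B" "\<And>x. x \<in> carrier H \<Longrightarrow> hnorm H (T x) \<le> B * hnorm H x"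
  shows "opnorm H T \<le> B"
  unfolding opnorm_def by (rule cInf_lower) (use assms in \<open>auto intro: bdd_belowI[of _ 0]\<close>)

section \<open>Projections and their orthogonal sums\<close>

lemma projection_idem: "is_projection H p \<Longrightarrow> x \<in> carrier H \<Longrightarrow> p (p x) = p x"
  and projection_adjoint:
    "\<lbrakk>is_projection H p; x \<in> carrier H; y \<in> carrier H\<rbrakk> \<Longrightarrow> ip H (p x) y = ip H x (p y)"
  by (simp_all add: is_projection_def adjoint_pair_def)

lemma projection_contraction:
  assumes "p \<in> bounded_ops H" "is_projection H p" "x \<in> carrier H"
  shows "hnorm H (p x) \<le> hnorm H x"
proof -
  have px: "p x \<in> carrier H" using assms bounded_opsD by blast
  have "(hnorm H (p x))\<^sup>2 = Re (ip H x (p x))"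
    using assms px by (simp add: hnorm_power2 projection_adjoint projection_idem)
  also have "\<dots> \<le> hnorm H x * hnorm H (p x)"
    using Cauchy_Schwarz[OF assms(3) px] complex_Re_le_cmod order_trans by blast
  finally have "hnorm H (p x) * hnorm H (p x) \<le> hnorm H x * hnorm H (p x)"
    by (simp only: power2_eq_square)
  then show ?thesis
    using hnorm_nonneg[OF px] hnorm_nonneg[OF assms(3)]
    by (cases "hnorm H (p x) = 0") (simp_all add: mult_le_cancel_right)
qed

text \<open>Pythagoras: \<open>p x\<close> is also the projection of \<open>q x\<close>, so the
  remainder \<open>q x \<ominus> p x\<close> is orthogonal to \<open>p x\<close>.\<close>

lemma projection_hdist:
  assumes "p \<in> bounded_ops H" "is_projection H p" "q \<in> bounded_ops H" "is_projection H q"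
    and "p (q x) = p x" "x \<in> carrier H"
  shows "(hdist H (q x) (p x))\<^sup>2 = (hnorm H (q x))\<^sup>2 - (hnorm H (p x))\<^sup>2"
proof -
  have c: "p x \<in> carrier H" "q x \<in> carrier H" using assms bounded_opsD by blast+
  have "ip H (p x) (q x) = ip H (p x) (p x)"
    using assms c projection_adjoint[of p "p x" "q x"] projection_adjoint[of p "p x" x]
      projection_idem[of p x] by metis
  moreover from this have "ip H (q x) (p x) = ip H (p x) (p x)"
    using ip_cnj[of "p x" "q x"] c by (simp add: ip_self)
  ultimately have "ip H (q x \<ominus> p x) (q x \<ominus> p x) = ip H (q x) (q x) - ip H (p x) (p x)"
    using c by (simp add: ip_diff_left ip_diff_right)
  then show ?thesis
    unfolding hdist_def using c by (simp add: hnorm_power2)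
qed

text \<open>Orthogonality in both orders removes the mixed terms of \<open>r (r x)\<close>.\<close>

lemma projection_add:
  assumes "p \<in> bounded_ops H" "is_projection H p" "q \<in> bounded_ops H" "is_projection H q"
    and "\<And>x. x \<in> carrier H \<Longrightarrow> p (q x) = \<zero>" "\<And>x. x \<in> carrier H \<Longrightarrow> q (p x) = \<zero>"
    and r: "\<And>x. x \<in> carrier H \<Longrightarrow> r x = p x \<oplus> q x"
  shows "is_projection H r"
proof -
  have c: "p x \<in> carrier H" "q x \<in> carrier H" if "x \<in> carrier H" for x
    using assms bounded_opsD that by blast+
  show ?thesis
    unfolding is_projection_def adjoint_pair_def
  proof (intro conjI ballI)
    fix x assume x: "x \<in> carrier H"
    then show "r (r x) = r x"
      using assms c by (simp add: bounded_opsD(2) projection_idem)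
    fix y assume y: "y \<in> carrier H"
    then show "ip H (r x) y = ip H x (r y)"
      using x assms c by (simp add: ip_add_left ip_add_right projection_adjoint)
  qed
qed

end

text \<open>All relations are asked for indices up to \<open>N\<close> only: along \<open>F\<close>
  finitely many of them hold simultaneously, the whole infinite list need not. Facts on partial sums
  are proved here, in one ordinary Hilbert space, and reach the internal operators by interpretation
  in the fibres.\<close>

locale projection_sums = hilbert +
  fixes P Q :: "nat \<Rightarrow> 'a \<Rightarrow> 'a" and N :: nat
  assumes P: "i \<le> N \<Longrightarrow> P i \<in> bounded_ops H" "i \<le> N \<Longrightarrow> is_projection H (P i)"
    and P_orth: "\<lbrakk>i \<le> N; j \<le> N; i \<noteq> j; x \<in> carrier H\<rbrakk> \<Longrightarrow> P i (P j x) = \<zero>"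
    and Q: "i \<le> N \<Longrightarrow> Q i \<in> bounded_ops H"
    and Q_0: "x \<in> carrier H \<Longrightarrow> Q 0 x = P 0 x"
    and Q_Suc: "\<lbrakk>Suc i \<le> N; x \<in> carrier H\<rbrakk> \<Longrightarrow> Q (Suc i) x = Q i x \<oplus> P (Suc i) x"
begin

lemma P_closed [simp]: "i \<le> N \<Longrightarrow> x \<in> carrier H \<Longrightarrow> P i x \<in> carrier H"
  and Q_closed [simp]: "i \<le> N \<Longrightarrow> x \<in> carrier H \<Longrightarrow> Q i x \<in> carrier H"
  using P Q bounded_opsD by blast+

lemma Q_P: "\<lbrakk>m \<le> N; i \<le> N; x \<in> carrier H\<rbrakk> \<Longrightarrow> Q m (P i x) = (if i \<le> m then P i x else \<zero>)"
proof (induction m)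
  case 0
  then show ?case using P(2)[of 0] by (auto simp: Q_0 P_orth projection_idem)
next
  case (Suc m)
  have "Q (Suc m) (P i x) = Q m (P i x) \<oplus> P (Suc m) (P i x)"
    using Suc.prems by (simp add: Q_Suc)
  then show ?case
    using Suc P(2)[of i] by (cases "i = Suc m") (auto simp: P_orth projection_idem)
qed

lemma P_Q: "\<lbrakk>m \<le> N; i \<le> N; m < i; x \<in> carrier H\<rbrakk> \<Longrightarrow> P i (Q m x) = \<zero>"
proof (induction m)
  case (Suc m)
  then show ?case
    using P(1)[of i] by (simp add: Q_Suc bounded_opsD(2) P_orth)
qed (simp add: Q_0 P_orth)

lemma Q_projection: "m \<le> N \<Longrightarrow> is_projection H (Q m)"
proof (induction m)
  case 0
  then show ?case
    using P(2)[of 0] by (simp add: is_projection_def adjoint_pair_def Q_0)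
next
  case (Suc m)
  show ?case
    by (rule projection_add[of "Q m" "P (Suc m)"]) (use Suc P Q in \<open>simp_all add: Q_P P_Q Q_Suc\<close>)
qed

lemma Q_Q_right: "\<lbrakk>m \<le> k; k \<le> N; x \<in> carrier H\<rbrakk> \<Longrightarrow> Q m (Q k x) = Q m x"
proof (induction k rule: dec_induct)
  case base
  then show ?case using Q_projection[of m] by (simp add: projection_idem)
next
  case (step k)
  then show ?case using Q[of m] by (simp add: Q_Suc bounded_opsD(2) Q_P)
qed

lemma Q_eq_zero: "\<lbrakk>m \<le> N; x \<in> carrier H; \<And>i. i \<le> m \<Longrightarrow> P i x = \<zero>\<rbrakk> \<Longrightarrow> Q m x = \<zero>"
  by (induction m) (simp_all add: Q_0 Q_Suc)

text \<open>Reduces the Cauchy property of the vectors \<open>Q m x\<close> to that of the real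
  numbers given by their squared norms.\<close>

lemma Q_hdist:
  "\<lbrakk>m \<le> k; k \<le> N; x \<in> carrier H\<rbrakk> \<Longrightarrow>
     (hdist H (Q k x) (Q m x))\<^sup>2 = (hnorm H (Q k x))\<^sup>2 - (hnorm H (Q m x))\<^sup>2"
  by (rule projection_hdist) (simp_all add: Q Q_projection Q_Q_right)

end

section \<open>The hull of an internal Hilbert space\<close>

lemma rep_mem: "x \<in> A \<Longrightarrow> rep A \<in> A"
  unfolding rep_def by (rule someI)

locale internal_algebra = nonstandard U \<kappa>
  for U :: "('a, 'b) nonstandard_universe" and \<kappa> :: "'k rel" +
  fixes J :: "'a set" and \<H> :: "'a \<Rightarrow> (complex, 'a) inner_space"
    and K :: "'a \<Rightarrow> 'a set" and op :: "'a \<Rightarrow> 'a \<Rightarrow> 'a \<Rightarrow> 'a" and c :: 'b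
  assumes J: "j \<in> J \<Longrightarrow> complex_hilbert_space (\<H> j)"
      "j \<in> J \<Longrightarrow> unital_cstar_algebra_on (\<H> j) (op j ` K j)"
    and c: "c \<in> set_star U J"
begin

abbreviation "H \<equiv> hilbert_star U \<H> c"

abbreviation "M \<equiv> ops_star U \<H> K op c"

abbreviation "Hh \<equiv> hilbert_hull U H"

text \<open>The fibre at the evaluation \<open>e\<close>. It is a Hilbert space for eventually all
  \<open>e\<close>, not for every \<open>e\<close>, so fibrewise arguments start from
  \<open>eventually_hilbert\<close>.\<close>

abbreviation S :: "('b \<Rightarrow> 'a) \<Rightarrow> (complex, 'a) inner_space" where
  "S e \<equiv> \<H> (e c)"

section \<open>Fibrewise description of the internal space\<close>

lemma eventually_J: "\<forall>\<^sub>F e in F. e c \<in> J"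
  using c unfolding set_star_def by (simp add: rel_star_iff_eventually)

lemma eventually_hilbert: "\<forall>\<^sub>F e in F. hilbert (S e)"
  using eventually_J by (rule eventually_mono) (simp add: J hilbert_def)

lemma carrier_iff: "x \<in> carrier H \<longleftrightarrow> (\<forall>\<^sub>F e in F. e x \<in> carrier (S e))"
  unfolding hilbert_star_def by (simp add: rel_star_iff_eventually)

lemma eventually_not_carrier: "x \<notin> carrier H \<longleftrightarrow> (\<forall>\<^sub>F e in F. e x \<notin> carrier (S e))"
  using eventually_not_F[of "\<lambda>l. l ! 1 \<in> carrier (\<H> (l ! 0))" "[c, x]"] by (simp add: carrier_iff)

text \<open>Vectors outside the carrier satisfy the implication vacuously, which needs that
  non-membership also holds eventually; \<open>c\<close> joins the parameters because the carrier of
  the fibre depends on it.\<close>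

lemma eventually_ball:
  assumes "\<And>x. x \<in> carrier H \<Longrightarrow> \<forall>\<^sub>F e in F. Q (e x) (map e ps)"
  shows "\<forall>\<^sub>F e in F. \<forall>a\<in>carrier (S e). Q a (map e ps)"
proof -
  have "\<forall>\<^sub>F e in F. e x \<in> carrier (S e) \<longrightarrow> Q (e x) (map e ps)" for x
  proof (cases "x \<in> carrier H")
    case True
    from assms[OF this] show ?thesis by (rule eventually_mono) simp
  next
    case False
    then show ?thesis unfolding eventually_not_carrier by (rule eventually_mono) simp
  qed
  then have "\<forall>\<^sub>F e in F. \<forall>a. a \<in> carrier (\<H> (hd (map e (c # ps)))) \<longrightarrow> Q a (tl (map e (c # ps)))"
    by (intro eventually_all[of "\<lambda>a l. a \<in> carrier (\<H> (hd l)) \<longrightarrow> Q a (tl l)" "c # ps"]) simp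
  then show ?thesis by (rule eventually_mono) simp
qed

lemma eventually_zero: "\<forall>\<^sub>F e in F. e \<zero>\<^bsub>H\<^esub> = \<zero>\<^bsub>S e\<^esub>"
  unfolding hilbert_star_def
  using eventually_fun_star[of "\<lambda>l. \<zero>\<^bsub>\<H> (l ! 0)\<^esub>" "[c]"] by simp

lemma eventually_add: "\<forall>\<^sub>F e in F. e (x \<oplus>\<^bsub>H\<^esub> y) = e x \<oplus>\<^bsub>S e\<^esub> e y"
  unfolding hilbert_star_def
  using eventually_fun_star[of "\<lambda>l. l ! 1 \<oplus>\<^bsub>\<H> (l ! 0)\<^esub> l ! 2" "[c, x, y]"] by simp

lemma eventually_smult: "\<forall>\<^sub>F e in F. e (z \<odot>\<^bsub>H\<^esub> x) = denum U (e z) \<odot>\<^bsub>S e\<^esub> e x"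
  unfolding hilbert_star_def
  using eventually_fun_star[of "\<lambda>l. denum U (l ! 1) \<odot>\<^bsub>\<H> (l ! 0)\<^esub> l ! 2" "[c, z, x]"] by simp

lemma eventually_ip: "\<forall>\<^sub>F e in F. e (ip H x y) = num U (ip (S e) (e x) (e y))"
  unfolding hilbert_star_def
  using eventually_fun_star[of "\<lambda>l. num U (ip (\<H> (l ! 0)) (l ! 1) (l ! 2))" "[c, x, y]"] by simp

lemma zero_closed [simp]: "\<zero>\<^bsub>H\<^esub> \<in> carrier H"
  unfolding carrier_iff using eventually_hilbert eventually_zero
proof eventually_elim
  case (elim e)
  interpret hilbert "S e" by fact
  from elim show ?case by simp
qed

lemma add_closed [simp]:
  assumes "x \<in> carrier H" "y \<in> carrier H"
  shows "x \<oplus>\<^bsub>H\<^esub> y \<in> carrier H"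
  using eventually_hilbert assms eventually_add[of x y] unfolding carrier_iff
proof eventually_elim
  case (elim e)
  interpret hilbert "S e" by fact
  from elim show ?case by simp
qed

lemma smult_closed [simp]:
  assumes "x \<in> carrier H"
  shows "z \<odot>\<^bsub>H\<^esub> x \<in> carrier H"
  using eventually_hilbert assms eventually_smult[of z x] unfolding carrier_iff
proof eventually_elim
  case (elim e)
  interpret hilbert "S e" by fact
  from elim show ?case by simp
qed

text \<open>\<open>hilbert_star\<close> extends no negation, and \<open>\<ominus>\<close> in
  \<open>H\<close> is a definite description in its additive monoid. It is found to be the multiple
  by -1, whose values in the fibres are known.\<close>

lemma eventually_minus:
  assumes "x \<in> carrier H"
  shows "\<forall>\<^sub>F e in F. e (\<ominus>\<^bsub>H\<^esub> x) = \<ominus>\<^bsub>S e\<^esub> e x"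
proof -
  let ?y = "cnum U (-1) \<odot>\<^bsub>H\<^esub> x"
  have y: "\<forall>\<^sub>F e in F. e ?y = \<ominus>\<^bsub>S e\<^esub> e x"
    using eventually_hilbert assms eventually_smult[of "cnum U (-1)" x] eventually_cnum[of "-1"]
    unfolding carrier_iff
  proof eventually_elim
    case (elim e)
    interpret hilbert "S e" by fact
    from elim show ?case by (simp add: minus_eq_smult)
  qed
  have 1: "x \<oplus>\<^bsub>H\<^esub> ?y = \<zero>\<^bsub>H\<^esub>" "?y \<oplus>\<^bsub>H\<^esub> x = \<zero>\<^bsub>H\<^esub>"
  proof -
    show "x \<oplus>\<^bsub>H\<^esub> ?y = \<zero>\<^bsub>H\<^esub>"
      unfolding eq_iff_eventually
      using eventually_hilbert assms y eventually_add[of x ?y] eventually_zero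
      unfolding carrier_iff
    proof eventually_elim
      case (elim e)
      interpret hilbert "S e" by fact
      from elim show ?case by (simp add: r_neg)
    qed
    show "?y \<oplus>\<^bsub>H\<^esub> x = \<zero>\<^bsub>H\<^esub>"
      unfolding eq_iff_eventually
      using eventually_hilbert assms y eventually_add[of ?y x] eventually_zero
      unfolding carrier_iff
    proof eventually_elim
      case (elim e)
      interpret hilbert "S e" by fact
      from elim show ?case by (simp add: l_neg)
    qed
  qed
  have "\<ominus>\<^bsub>H\<^esub> x = ?y"
    unfolding a_inv_def m_inv_def
  proof (rule the_equality)
    fix z assume z: "z \<in> carrier (add_monoid H) \<and> x \<otimes>\<^bsub>add_monoid H\<^esub> z = \<one>\<^bsub>add_monoid H\<^esub> \<and>
      z \<otimes>\<^bsub>add_monoid H\<^esub> x = \<one>\<^bsub>add_monoid H\<^esub>"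
    then have z: "z \<in> carrier H" "x \<oplus>\<^bsub>H\<^esub> z = \<zero>\<^bsub>H\<^esub>" by simp_all
    have "\<forall>\<^sub>F e in F. e (x \<oplus>\<^bsub>H\<^esub> z) = \<zero>\<^bsub>S e\<^esub>" using eventually_zero by (simp add: z(2))
    then have "\<forall>\<^sub>F e in F. e z = \<ominus>\<^bsub>S e\<^esub> e x"
      using eventually_hilbert assms z(1) eventually_add[of x z] unfolding carrier_iff
    proof eventually_elim
      case (elim e)
      interpret hilbert "S e" by fact
      have "e z \<oplus>\<^bsub>S e\<^esub> e x = \<zero>\<^bsub>S e\<^esub>" using elim by (simp add: a_comm)
      with elim show ?case by (metis minus_equality)
    qed
    with y show "z = ?y" unfolding eq_iff_eventually[of z] by eventually_elim simp
  qed (use 1 assms in simp_all)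
  with y show ?thesis by simp
qed

lemma eventually_diff:
  assumes "x \<in> carrier H" "y \<in> carrier H"
  shows "\<forall>\<^sub>F e in F. e (x \<ominus>\<^bsub>H\<^esub> y) = e x \<ominus>\<^bsub>S e\<^esub> e y"
  using eventually_add[of x "\<ominus>\<^bsub>H\<^esub> y"] eventually_minus[OF assms(2)]
  by eventually_elim (simp add: a_minus_def)

lemma diff_closed [simp]:
  assumes "x \<in> carrier H" "y \<in> carrier H"
  shows "x \<ominus>\<^bsub>H\<^esub> y \<in> carrier H"
  using eventually_hilbert assms eventually_diff[OF assms] unfolding carrier_iff
proof eventually_elim
  case (elim e)
  interpret hilbert "S e" by fact
  from elim show ?case by simp
qed

lemma eventually_norm: "\<forall>\<^sub>F e in F. e (internal_norm U H x) = num U (of_real (hnorm (S e) (e x)))"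
  using eventually_ip[of x x] eventually_hc_lift1[of "\<lambda>z. of_real (sqrt (Re z))" "ip H x x"]
  unfolding internal_norm_def by eventually_elim (simp add: hnorm_def)

section \<open>Finite and infinitely close vectors\<close>

text \<open>One standard bound on the fibre norms; \<open>hc_finite_norm_iff\<close> ties it to
  hyperreal finiteness, so that later estimates are made with real numbers in the fibres.\<close>

definition Fin :: "'b set" where
  "Fin = {x \<in> carrier H. \<exists>B. \<forall>\<^sub>F e in F. hnorm (S e) (e x) \<le> B}"

definition near :: "'b \<Rightarrow> 'b \<Rightarrow> bool" where
  "near x y \<longleftrightarrow> ((\<lambda>e. hdist (S e) (e x) (e y)) \<longlongrightarrow> 0) F"

lemma Fin_carrier: "x \<in> Fin \<Longrightarrow> x \<in> carrier H"
  by (simp add: Fin_def)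

lemma hc_finite_norm_iff:
  assumes "x \<in> carrier H"
  shows "hc_finite U (internal_norm U H x) \<longleftrightarrow> x \<in> Fin"
proof -
  have "(\<forall>\<^sub>F e in F. cmod (denum U (e (internal_norm U H x))) \<le> B) \<longleftrightarrow>
      (\<forall>\<^sub>F e in F. hnorm (S e) (e x) \<le> B)" for B
  proof (rule eventually_subst)
    show "\<forall>\<^sub>F e in F. (cmod (denum U (e (internal_norm U H x))) \<le> B) \<longleftrightarrow> hnorm (S e) (e x) \<le> B"
      using eventually_hilbert assms eventually_norm[of x] unfolding carrier_iff
    proof eventually_elim
      case (elim e)
      interpret hilbert "S e" by fact
      from elim show ?case by simp
    qed
  qed
  then show ?thesis
    using assms by (simp add: hc_finite_iff Fin_def)
qed

lemma hc_approx_norm_diff_iff: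
  assumes "x \<in> carrier H" "y \<in> carrier H"
  shows "hc_approx U (internal_norm U H (x \<ominus>\<^bsub>H\<^esub> y)) (cnum U 0) \<longleftrightarrow> near x y"
proof -
  have "\<forall>\<^sub>F e in F. denum U (e (internal_norm U H (x \<ominus>\<^bsub>H\<^esub> y))) = of_real (hdist (S e) (e x) (e y))"
    using eventually_norm[of "x \<ominus>\<^bsub>H\<^esub> y"] eventually_diff[OF assms]
    by eventually_elim (simp add: hdist_def)
  then have "((\<lambda>e. denum U (e (internal_norm U H (x \<ominus>\<^bsub>H\<^esub> y)))) \<longlongrightarrow> 0) F \<longleftrightarrow>
      ((\<lambda>e. complex_of_real (hdist (S e) (e x) (e y))) \<longlongrightarrow> of_real 0) F"
    unfolding of_real_0 by (rule tendsto_cong)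
  then show ?thesis
    unfolding hc_approx_cnum_iff near_def tendsto_of_real_iff .
qed

lemma nearI:
  assumes "x \<in> carrier H" "y \<in> carrier H"
    and "\<forall>\<^sub>F e in F. hdist (S e) (e x) (e y) \<le> g e" "(g \<longlongrightarrow> 0) F"
  shows "near x y"
  unfolding near_def
proof (rule Lim_null_comparison)
  show "\<forall>\<^sub>F e in F. norm (hdist (S e) (e x) (e y)) \<le> g e"
    using eventually_hilbert assms(1-3) unfolding carrier_iff
  proof eventually_elim
    case (elim e)
    interpret hilbert "S e" by fact
    from elim show ?case by simp
  qed
qed fact

lemma near_refl [simp]: "x \<in> carrier H \<Longrightarrow> near x x"
proof (rule nearI)
  assume "x \<in> carrier H"
  with eventually_hilbert show "\<forall>\<^sub>F e in F. hdist (S e) (e x) (e x) \<le> 0"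
    unfolding carrier_iff
    by eventually_elim (simp add: hilbert.hdist_self)
qed simp_all

lemma near_sym:
  assumes "x \<in> carrier H" "y \<in> carrier H" "near x y"
  shows "near y x"
proof (rule nearI)
  from eventually_hilbert assms(1,2)
  show "\<forall>\<^sub>F e in F. hdist (S e) (e y) (e x) \<le> hdist (S e) (e x) (e y)"
    unfolding carrier_iff
    by eventually_elim (simp add: hilbert.hdist_commute)
qed (use assms in \<open>simp_all add: near_def\<close>)

lemma near_trans:
  assumes "x \<in> carrier H" "y \<in> carrier H" "z \<in> carrier H" "near x y" "near y z"
  shows "near x z"
proof (rule nearI)
  from eventually_hilbert assms(1-3)
  show "\<forall>\<^sub>F e in F. hdist (S e) (e x) (e z) \<le> hdist (S e) (e x) (e y) + hdist (S e) (e y) (e z)"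
    unfolding carrier_iff
    by eventually_elim (simp add: hilbert.hdist_triangle)
  show "((\<lambda>e. hdist (S e) (e x) (e y) + hdist (S e) (e y) (e z)) \<longlongrightarrow> 0) F"
    using assms(4,5) unfolding near_def by (rule tendsto_add_zero)
qed (use assms in simp_all)

lemma mem_vec_hat: "x \<in> carrier H \<Longrightarrow> y \<in> vec_hat U H x \<longleftrightarrow> y \<in> carrier H \<and> near y x"
  unfolding vec_hat_def hat_def using hc_approx_norm_diff_iff by auto

lemma vec_hat_eq_iff:
  assumes "x \<in> carrier H" "y \<in> carrier H"
  shows "vec_hat U H x = vec_hat U H y \<longleftrightarrow> near x y"
proof
  assume "vec_hat U H x = vec_hat U H y"
  then have "x \<in> vec_hat U H y" using assms(1) mem_vec_hat near_refl by blast
  then show "near x y" using assms mem_vec_hat by blast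
next
  assume "near x y"
  with assms show "vec_hat U H x = vec_hat U H y"
    using near_sym[of x y] by (auto simp: mem_vec_hat intro: near_trans)
qed

lemma rep_vec_hat:
  assumes "x \<in> carrier H"
  shows "rep (vec_hat U H x) \<in> carrier H" "near (rep (vec_hat U H x)) x"
proof -
  have "x \<in> vec_hat U H x" using assms mem_vec_hat by simp
  then have "rep (vec_hat U H x) \<in> vec_hat U H x" by (rule rep_mem)
  then show "rep (vec_hat U H x) \<in> carrier H" "near (rep (vec_hat U H x)) x"
    using assms mem_vec_hat by simp_all
qed

lemma near_Fin:
  assumes "x \<in> Fin" "y \<in> carrier H" "near y x"
  shows "y \<in> Fin"
proof -
  obtain B where B: "\<forall>\<^sub>F e in F. hnorm (S e) (e x) \<le> B" using assms by (auto simp: Fin_def)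
  have "\<forall>\<^sub>F e in F. hdist (S e) (e y) (e x) < 1"
    using assms(3) unfolding near_def by (rule order_tendstoD) simp
  with B eventually_hilbert assms(2) Fin_carrier[OF assms(1)]
  have "\<forall>\<^sub>F e in F. hnorm (S e) (e y) \<le> 1 + B"
    unfolding carrier_iff
  proof eventually_elim
    case (elim e)
    interpret hilbert "S e" by fact
    from elim hnorm_le_hdist[of "e y" "e x"] show ?case by simp
  qed
  with assms(2) show ?thesis by (auto simp: Fin_def)
qed

section \<open>Operations and norm of the hull\<close>

lemma carrier_hull: "carrier Hh = vec_hat U H ` Fin"
  unfolding hilbert_hull_def nonstandard_hull_def vec_hat_def
  using hc_finite_norm_iff Fin_carrier by (auto simp del: partial_object.simps simp add: partial_object.simps)

lemma add_Fin:
  assumes "x \<in> Fin" "y \<in> Fin"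
  shows "x \<oplus>\<^bsub>H\<^esub> y \<in> Fin"
proof -
  obtain A B where "\<forall>\<^sub>F e in F. hnorm (S e) (e x) \<le> A" "\<forall>\<^sub>F e in F. hnorm (S e) (e y) \<le> B"
    using assms by (auto simp: Fin_def)
  with eventually_hilbert eventually_add[of x y] Fin_carrier[OF assms(1)] Fin_carrier[OF assms(2)]
  have "\<forall>\<^sub>F e in F. hnorm (S e) (e (x \<oplus>\<^bsub>H\<^esub> y)) \<le> A + B"
    unfolding carrier_iff
  proof eventually_elim
    case (elim e)
    interpret hilbert "S e" by fact
    from elim hnorm_triangle[of "e x" "e y"] show ?case by simp
  qed
  then show ?thesis using assms by (auto simp: Fin_def)
qed

lemma smult_Fin:
  assumes "x \<in> Fin"
  shows "cnum U z \<odot>\<^bsub>H\<^esub> x \<in> Fin"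
proof -
  obtain A where "\<forall>\<^sub>F e in F. hnorm (S e) (e x) \<le> A"
    using assms by (auto simp: Fin_def)
  with eventually_hilbert eventually_smult[of "cnum U z" x] Fin_carrier[OF assms(1)] eventually_cnum[of z]
  have "\<forall>\<^sub>F e in F. hnorm (S e) (e (cnum U z \<odot>\<^bsub>H\<^esub> x)) \<le> cmod z * A"
    unfolding carrier_iff
  proof eventually_elim
    case (elim e)
    interpret hilbert "S e" by fact
    from elim show ?case by (simp add: hnorm_smult mult_left_mono)
  qed
  then show ?thesis using assms by (auto simp: Fin_def)
qed

lemma near_add:
  assumes "x \<in> carrier H" "y \<in> carrier H" "x' \<in> carrier H" "y' \<in> carrier H" "near x x'" "near y y'"
  shows "near (x \<oplus>\<^bsub>H\<^esub> y) (x' \<oplus>\<^bsub>H\<^esub> y')"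
proof (rule nearI)
  from eventually_hilbert assms(1-4) eventually_add[of x y] eventually_add[of x' y']
  show "\<forall>\<^sub>F e in F. hdist (S e) (e (x \<oplus>\<^bsub>H\<^esub> y)) (e (x' \<oplus>\<^bsub>H\<^esub> y')) \<le>
      hdist (S e) (e x) (e x') + hdist (S e) (e y) (e y')"
    unfolding carrier_iff
    by eventually_elim (simp add: hilbert.hdist_add)
  show "((\<lambda>e. hdist (S e) (e x) (e x') + hdist (S e) (e y) (e y')) \<longlongrightarrow> 0) F"
    using assms(5,6) unfolding near_def by (rule tendsto_add_zero)
qed (use assms in simp_all)

lemma near_smult:
  assumes "x \<in> carrier H" "x' \<in> carrier H" "near x x'"
  shows "near (cnum U z \<odot>\<^bsub>H\<^esub> x) (cnum U z \<odot>\<^bsub>H\<^esub> x')"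
proof (rule nearI)
  from eventually_hilbert assms(1-2) eventually_smult[of "cnum U z" x]
    eventually_smult[of "cnum U z" x'] eventually_cnum[of z]
  show "\<forall>\<^sub>F e in F. hdist (S e) (e (cnum U z \<odot>\<^bsub>H\<^esub> x)) (e (cnum U z \<odot>\<^bsub>H\<^esub> x')) \<le>
      cmod z * hdist (S e) (e x) (e x')"
    unfolding carrier_iff
    by eventually_elim (simp add: hilbert.hdist_smult)
  show "((\<lambda>e. cmod z * hdist (S e) (e x) (e x')) \<longlongrightarrow> 0) F"
    using assms(3) unfolding near_def by (rule tendsto_mult_right_zero)
qed (use assms in simp_all)

text \<open>Independence of representatives: the hull adds chosen members of the classes, and
  infinitely close summands have infinitely close sums.\<close>

lemma hull_add:
  assumes "x \<in> carrier H" "y \<in> carrier H"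
  shows "vec_hat U H x \<oplus>\<^bsub>Hh\<^esub> vec_hat U H y = vec_hat U H (x \<oplus>\<^bsub>H\<^esub> y)"
proof -
  have "vec_hat U H x \<oplus>\<^bsub>Hh\<^esub> vec_hat U H y =
      vec_hat U H (rep (vec_hat U H x) \<oplus>\<^bsub>H\<^esub> rep (vec_hat U H y))"
    by (simp add: hilbert_hull_def)
  also have "\<dots> = vec_hat U H (x \<oplus>\<^bsub>H\<^esub> y)"
    using assms rep_vec_hat near_add by (subst vec_hat_eq_iff) simp_all
  finally show ?thesis .
qed

lemma hull_smult:
  assumes "x \<in> carrier H"
  shows "z \<odot>\<^bsub>Hh\<^esub> vec_hat U H x = vec_hat U H (cnum U z \<odot>\<^bsub>H\<^esub> x)"
proof -
  have "z \<odot>\<^bsub>Hh\<^esub> vec_hat U H x = vec_hat U H (cnum U z \<odot>\<^bsub>H\<^esub> rep (vec_hat U H x))"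
    by (simp add: hilbert_hull_def)
  also have "\<dots> = vec_hat U H (cnum U z \<odot>\<^bsub>H\<^esub> x)"
    using assms rep_vec_hat near_smult by (subst vec_hat_eq_iff) simp_all
  finally show ?thesis .
qed

text \<open>The hull norm rests on a definite description, a standard part taken at
  \<open>rep\<close>. Finiteness bounds the inner products, compactness supplies their limit along
  \<open>F\<close>, and that limit is the standard part.\<close>

lemma tendsto_hnorm_hull:
  assumes "x \<in> Fin"
  shows "((\<lambda>e. hnorm (S e) (e (rep (vec_hat U H x)))) \<longlongrightarrow> hnorm Hh (vec_hat U H x)) F"
proof -
  let ?y = "rep (vec_hat U H x)"
  have y: "?y \<in> Fin"
    using near_Fin rep_vec_hat assms Fin_carrier by blast
  then obtain B where B: "\<forall>\<^sub>F e in F. hnorm (S e) (e ?y) \<le> B" by (auto simp: Fin_def)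
  have "\<forall>\<^sub>F e in F. cmod (ip (S e) (e ?y) (e ?y)) \<le> B\<^sup>2"
    using eventually_hilbert B Fin_carrier[OF y] unfolding carrier_iff
  proof eventually_elim
    case (elim e)
    interpret hilbert "S e" by fact
    from elim show ?case by (simp add: ip_self norm_power power_mono)
  qed
  then obtain w where w: "((\<lambda>e. ip (S e) (e ?y) (e ?y)) \<longlongrightarrow> w) F"
    using internal_tendsto[of "\<lambda>l. ip (\<H> (l ! 0)) (l ! 1) (l ! 1)" "[c, ?y]"] by auto
  have "((\<lambda>e. denum U (e (ip H ?y ?y))) \<longlongrightarrow> w) F"
    by (rule Lim_transform_eventually[OF w])
      (rule eventually_mono[OF eventually_ip[of ?y ?y]], simp)
  then have "ip Hh (vec_hat U H x) (vec_hat U H x) = w"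
    unfolding hilbert_hull_def by (simp add: standard_part_eqI)
  then have "hnorm Hh (vec_hat U H x) = sqrt (Re w)" by (simp add: hnorm_def)
  moreover have "((\<lambda>e. sqrt (Re (ip (S e) (e ?y) (e ?y)))) \<longlongrightarrow> sqrt (Re w)) F"
    by (intro tendsto_real_sqrt tendsto_Re w)
  ultimately show ?thesis by (simp add: hnorm_def)
qed

end

section \<open>Internal operators and their hulls\<close>

context internal_algebra
begin

text \<open>The elements of \<open>M\<close> are functions of the logic, over which transfer cannot
  quantify; their names are objects, and \<open>Op k\<close> is the operator named
  \<open>k\<close>.\<close>

definition Op :: "'b \<Rightarrow> 'b \<Rightarrow> 'b" where
  "Op k = restrict (\<lambda>x. fun_star U (\<lambda>l. op (l ! 0) (l ! 1) (l ! 2)) [c, k, x]) (carrier H)"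

abbreviation oper :: "('b \<Rightarrow> 'a) \<Rightarrow> 'b \<Rightarrow> 'a \<Rightarrow> 'a" where
  "oper e k \<equiv> op (e c) (e k)"

definition names :: "'b set" where
  "names = {k. \<forall>\<^sub>F e in F. e k \<in> K (e c)}"

lemma M_eq: "M = Op ` names"
  unfolding ops_star_def Op_def names_def by (simp add: rel_star_iff_eventually)

lemma eventually_Op: "x \<in> carrier H \<Longrightarrow> \<forall>\<^sub>F e in F. e (Op k x) = oper e k (e x)"
  unfolding Op_def
  using eventually_fun_star[of "\<lambda>l. op (l ! 0) (l ! 1) (l ! 2)" "[c, k, x]"] by simp

lemma eventually_algebra: "\<forall>\<^sub>F e in F. unital_cstar_algebra_on (S e) (op (e c) ` K (e c))"
  using eventually_J by (rule eventually_mono) (rule J)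

lemma eventually_names: "k \<in> names \<Longrightarrow> \<forall>\<^sub>F e in F. e k \<in> K (e c)"
  by (simp add: names_def)

lemma eventually_bounded_op:
  assumes "k \<in> names"
  shows "\<forall>\<^sub>F e in F. oper e k \<in> bounded_ops (S e)"
  using eventually_algebra eventually_names[OF assms]
  by eventually_elim (auto simp: unital_cstar_algebra_on_def)

lemma Op_closed [simp]:
  assumes "k \<in> names" "x \<in> carrier H"
  shows "Op k x \<in> carrier H"
  using eventually_hilbert eventually_bounded_op[OF assms(1)] assms(2) eventually_Op[OF assms(2), of k]
  unfolding carrier_iff by eventually_elim (simp add: hilbert.bounded_opsD(1))

lemma Op_eqI:
  assumes "T \<in> extensional (carrier H)"
    and "\<And>x. x \<in> carrier H \<Longrightarrow> \<forall>\<^sub>F e in F. e (T x) = oper e k (e x)"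
  shows "Op k = T"
proof (rule extensionalityI)
  show "Op k \<in> extensional (carrier H)" by (simp add: Op_def)
  fix x assume x: "x \<in> carrier H"
  show "Op k x = T x"
    unfolding eq_iff_eventually using eventually_Op[OF x, of k] assms(2)[OF x] by eventually_elim simp
qed (fact assms(1))

text \<open>Closure of the fibre algebras under sums gives a name in each fibre, and
  \<open>eventually_ex\<close> turns these into one internal name.\<close>

lemma ex_name_add:
  assumes "k \<in> names" "k' \<in> names"
  shows "\<exists>k''\<in>names. \<forall>\<^sub>F e in F. \<forall>a\<in>carrier (S e). oper e k'' a = oper e k a \<oplus>\<^bsub>S e\<^esub> oper e k' a"
proof -
  have "\<forall>\<^sub>F e in F. \<exists>b. b \<in> K (e c) \<and>
      (\<forall>a\<in>carrier (S e). op (e c) b a = oper e k a \<oplus>\<^bsub>S e\<^esub> oper e k' a)"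
    using eventually_algebra eventually_names[OF assms(1)] eventually_names[OF assms(2)]
  proof eventually_elim
    case (elim e)
    then have "restrict (\<lambda>a. oper e k a \<oplus>\<^bsub>S e\<^esub> oper e k' a) (carrier (S e)) \<in> op (e c) ` K (e c)"
      unfolding unital_cstar_algebra_on_def by blast
    then obtain b where "b \<in> K (e c)"
      "op (e c) b = restrict (\<lambda>a. oper e k a \<oplus>\<^bsub>S e\<^esub> oper e k' a) (carrier (S e))" by auto
    then show ?case by (intro exI[of _ b]) simp
  qed
  then obtain k'' where "\<forall>\<^sub>F e in F. e k'' \<in> K (e c) \<and>
      (\<forall>a\<in>carrier (S e). oper e k'' a = oper e k a \<oplus>\<^bsub>S e\<^esub> oper e k' a)"
    using eventually_ex[of "\<lambda>b l. b \<in> K (l ! 0) \<and>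
      (\<forall>a\<in>carrier (\<H> (l ! 0)). op (l ! 0) b a = op (l ! 0) (l ! 1) a \<oplus>\<^bsub>\<H> (l ! 0)\<^esub> op (l ! 0) (l ! 2) a)"
        "[c, k, k']"] by auto
  then show ?thesis
    unfolding names_def by (intro bexI[of _ k'']) (auto elim: eventually_mono)
qed

lemma ex_name_diff:
  assumes "k \<in> names" "k' \<in> names"
  shows "\<exists>k''\<in>names. \<forall>\<^sub>F e in F. oper e k'' = op_diff (S e) (oper e k) (oper e k')"
proof -
  have "\<forall>\<^sub>F e in F. \<exists>b. b \<in> K (e c) \<and> op (e c) b = op_diff (S e) (oper e k) (oper e k')"
    using eventually_hilbert eventually_algebra eventually_names[OF assms(1)] eventually_names[OF assms(2)]
      eventually_bounded_op[OF assms(2)]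
  proof eventually_elim
    case (elim e)
    interpret hilbert "S e" by fact
    have add: "restrict (\<lambda>x. A x \<oplus>\<^bsub>S e\<^esub> B x) (carrier (S e)) \<in> op (e c) ` K (e c)"
      if "A \<in> op (e c) ` K (e c)" "B \<in> op (e c) ` K (e c)" for A B
      using elim(2) that unfolding unital_cstar_algebra_on_def by blast
    have smult: "restrict (\<lambda>x. z \<odot>\<^bsub>S e\<^esub> A x) (carrier (S e)) \<in> op (e c) ` K (e c)"
      if "A \<in> op (e c) ` K (e c)" for A z
      using elim(2) that unfolding unital_cstar_algebra_on_def by blast
    \<comment> \<open>Closure under differences is not among the axioms of the algebra; the
      difference is built as a sum with the multiple by -1.\<close>
    have "restrict (\<lambda>x. oper e k x \<oplus>\<^bsub>S e\<^esub>
        restrict (\<lambda>x. (-1) \<odot>\<^bsub>S e\<^esub> oper e k' x) (carrier (S e)) x) (carrier (S e)) \<in> op (e c) ` K (e c)"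
      by (intro add smult imageI elim)
    also have "restrict (\<lambda>x. oper e k x \<oplus>\<^bsub>S e\<^esub>
        restrict (\<lambda>x. (-1) \<odot>\<^bsub>S e\<^esub> oper e k' x) (carrier (S e)) x) (carrier (S e)) =
        op_diff (S e) (oper e k) (oper e k')"
      unfolding op_diff_def
      by (rule restrict_ext) (use bounded_opsD(1)[OF elim(5)] in \<open>simp add: a_minus_def minus_eq_smult\<close>)
    finally show ?case by auto
  qed
  then obtain k'' where "\<forall>\<^sub>F e in F. e k'' \<in> K (e c) \<and> oper e k'' = op_diff (S e) (oper e k) (oper e k')"
    using eventually_ex[of "\<lambda>b l. b \<in> K (l ! 0) \<and>
      op (l ! 0) b = op_diff (\<H> (l ! 0)) (op (l ! 0) (l ! 1)) (op (l ! 0) (l ! 2))" "[c, k, k']"] by auto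
  then show ?thesis
    unfolding names_def by (intro bexI[of _ k'']) (auto elim: eventually_mono)
qed

lemma op_diff_Op:
  assumes "k \<in> names" "k' \<in> names"
    and "\<forall>\<^sub>F e in F. oper e k'' = op_diff (S e) (oper e k) (oper e k')"
  shows "op_diff H (Op k) (Op k') = Op k''"
proof (rule Op_eqI[symmetric])
  fix x assume x: "x \<in> carrier H"
  have "\<forall>\<^sub>F e in F. e (Op k x \<ominus>\<^bsub>H\<^esub> Op k' x) = oper e k'' (e x)"
    using eventually_diff[OF Op_closed[OF assms(1) x] Op_closed[OF assms(2) x]]
      eventually_Op[OF x, of k] eventually_Op[OF x, of k'] assms(3) x[unfolded carrier_iff]
    by eventually_elim (simp add: op_diff_def)
  then show "\<forall>\<^sub>F e in F. e (op_diff H (Op k) (Op k') x) = oper e k'' (e x)"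
    using x by (simp add: op_diff_def)
qed (simp add: op_diff_def)

section \<open>The internal operator norm\<close>

text \<open>The left side tests each internal vector separately; \<open>eventually_ball\<close>
  gathers the tests into one bound in the fibre, to which \<open>opnorm\<close> applies.\<close>

lemma internal_op_bound_iff:
  assumes k: "k \<in> names"
  shows "internal_op_bound U H (Op k) B \<longleftrightarrow>
    (\<forall>\<^sub>F e in F. \<exists>b\<ge>0. e B = num U (of_real b) \<and>
      (\<forall>a\<in>carrier (S e). hnorm (S e) (oper e k a) \<le> b * hnorm (S e) a))" (is "?L \<longleftrightarrow> ?R")
proof
  assume L: ?L
  have 1: "\<forall>\<^sub>F e in F. \<exists>b\<ge>0. e B = num U (of_real b)"
  proof -
    have "hr_le U (cnum U 0) B" using L by (simp add: internal_op_bound_def)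
    then show ?thesis
      unfolding hr_le_iff using eventually_cnum[of 0]
    proof eventually_elim
      case (elim e)
      then obtain x y :: real where "num U 0 = num U (of_real x)" "e B = num U (of_real y)" "x \<le> y"
        by auto
      then show ?case using inj_num by (auto simp: inj_eq)
    qed
  qed
  \<comment> \<open>\<open>Re (denum U (e B))\<close> is the real number coded by
    \<open>e B\<close>, given as a term of the parameter value so that it can enter the relation for
    \<open>eventually_ball\<close>.\<close>
  have "\<forall>\<^sub>F e in F. hnorm (S e) (oper e k (e x)) \<le> Re (denum U (e B)) * hnorm (S e) (e x)"
    if x: "x \<in> carrier H" for x
  proof -
    have "hr_le U (internal_norm U H (Op k x)) (hc_lift2 U (*) B (internal_norm U H x))"
      using L x by (simp add: internal_op_bound_def)
    then show ?thesis
      unfolding hr_le_iff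
      using 1 eventually_norm[of "Op k x"] eventually_norm[of x] eventually_Op[OF x, of k]
        eventually_hc_lift2[of "(*)" B "internal_norm U H x"]
    proof eventually_elim
      case (elim e)
      then obtain x' y' b :: real where
        "num U (of_real (hnorm (S e) (oper e k (e x)))) = num U (of_real x')"
        "num U (of_real b * of_real (hnorm (S e) (e x))) = num U (of_real y')"
        "x' \<le> y'" "e B = num U (of_real b)" by auto
      then show ?case using inj_num by (auto simp: inj_eq simp flip: of_real_mult)
    qed
  qed
  then have "\<forall>\<^sub>F e in F. \<forall>a\<in>carrier (S e). hnorm (S e) (oper e k a) \<le> Re (denum U (e B)) * hnorm (S e) a"
    using eventually_ball[of "\<lambda>a l. hnorm (\<H> (l ! 0)) (op (l ! 0) (l ! 1) a) \<le>
        Re (denum U (l ! 2)) * hnorm (\<H> (l ! 0)) a" "[c, k, B]"] by simp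
  with 1 show ?R
    by eventually_elim auto
next
  assume R: ?R
  have "hr_le U (cnum U 0) B"
    unfolding hr_le_iff using R eventually_cnum[of 0]
  proof eventually_elim
    case (elim e)
    then obtain b :: real where "b \<ge> 0" "e B = num U (of_real b)" by auto
    with elim(2) show ?case by (intro exI[of _ 0] exI[of _ b]) simp
  qed
  moreover have "hr_le U (internal_norm U H (Op k x)) (hc_lift2 U (*) B (internal_norm U H x))"
    if x: "x \<in> carrier H" for x
    unfolding hr_le_iff
    using R x[unfolded carrier_iff] eventually_norm[of "Op k x"] eventually_norm[of x]
      eventually_Op[OF x, of k] eventually_hc_lift2[of "(*)" B "internal_norm U H x"]
  proof eventually_elim
    case (elim e)
    then obtain b :: real where b: "e B = num U (of_real b)"
      "hnorm (S e) (oper e k (e x)) \<le> b * hnorm (S e) (e x)" by auto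
    show ?case
      by (intro exI[of _ "hnorm (S e) (oper e k (e x))"] exI[of _ "b * hnorm (S e) (e x)"])
        (use elim b in simp)
  qed
  ultimately show ?L by (simp add: internal_op_bound_def)
qed

lemma hr_le_antisym:
  assumes "hr_le U r s" "hr_le U s r"
  shows "r = s"
  unfolding eq_iff_eventually using assms unfolding hr_le_iff
proof eventually_elim
  case (elim e)
  then show ?case using inj_num by (auto simp: inj_eq)
qed

text \<open>\<open>N\<close> is the extension of the fibrewise operator norm. It is an internal
  bound and the least one, and by antisymmetry of \<open>hr_le\<close> the definite description
  picks it.\<close>

lemma eventually_opnorm:
  assumes k: "k \<in> names"
  shows "\<forall>\<^sub>F e in F. e (internal_opnorm U H (Op k)) = num U (of_real (opnorm (S e) (oper e k)))"
proof -
  define N where "N = fun_star U (\<lambda>l. num U (of_real (opnorm (\<H> (l ! 0)) (op (l ! 0) (l ! 1))))) [c, k]"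
  have N: "\<forall>\<^sub>F e in F. e N = num U (of_real (opnorm (S e) (oper e k)))"
    unfolding N_def
    using eventually_fun_star[of "\<lambda>l. num U (of_real (opnorm (\<H> (l ! 0)) (op (l ! 0) (l ! 1))))" "[c, k]"]
    by simp
  have bound: "internal_op_bound U H (Op k) N"
    unfolding internal_op_bound_iff[OF k]
    using eventually_hilbert eventually_bounded_op[OF k] N
  proof eventually_elim
    case (elim e)
    interpret hilbert "S e" by fact
    show ?case
      by (intro exI[of _ "opnorm (S e) (oper e k)"])
        (use elim opnorm_nonneg opnorm_bound in simp)
  qed
  have least: "hr_le U N B" if "internal_op_bound U H (Op k) B" for B
    unfolding hr_le_iff
    using eventually_hilbert that[unfolded internal_op_bound_iff[OF k]] N
  proof eventually_elim
    case (elim e)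
    interpret hilbert "S e" by fact
    obtain b where b: "b \<ge> 0" "e B = num U (of_real b)"
      "\<forall>a\<in>carrier (S e). hnorm (S e) (oper e k a) \<le> b * hnorm (S e) a"
      using elim by blast
    then have "opnorm (S e) (oper e k) \<le> b" by (intro opnorm_le) auto
    with b elim show ?case by (intro exI[of _ "opnorm (S e) (oper e k)"] exI[of _ b]) simp
  qed
  have "internal_opnorm U H (Op k) = N"
    unfolding internal_opnorm_def
    by (rule the_equality) (use bound least hr_le_antisym in blast)+
  with N show ?thesis by simp
qed

section \<open>Operators of finite norm and the hull of the algebra\<close>

definition fin_names :: "'b set" where
  "fin_names = {k \<in> names. \<exists>B. \<forall>\<^sub>F e in F. opnorm (S e) (oper e k) \<le> B}"

lemma fin_names_names: "k \<in> fin_names \<Longrightarrow> k \<in> names"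
  by (simp add: fin_names_def)

lemma hc_finite_opnorm_iff:
  assumes k: "k \<in> names"
  shows "hc_finite U (internal_opnorm U H (Op k)) \<longleftrightarrow> k \<in> fin_names"
proof -
  have "(\<forall>\<^sub>F e in F. cmod (denum U (e (internal_opnorm U H (Op k)))) \<le> B) \<longleftrightarrow>
      (\<forall>\<^sub>F e in F. opnorm (S e) (oper e k) \<le> B)" for B
  proof (rule eventually_subst)
    show "\<forall>\<^sub>F e in F. (cmod (denum U (e (internal_opnorm U H (Op k)))) \<le> B) \<longleftrightarrow> opnorm (S e) (oper e k) \<le> B"
      using eventually_hilbert eventually_bounded_op[OF k] eventually_opnorm[OF k]
    proof eventually_elim
      case (elim e)
      interpret hilbert "S e" by fact
      from elim show ?case by (simp add: opnorm_nonneg)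
    qed
  qed
  then show ?thesis
    using assms by (simp add: hc_finite_iff fin_names_def)
qed

lemma hc_approx_opnorm_iff:
  assumes k: "k \<in> names"
  shows "hc_approx U (internal_opnorm U H (Op k)) (cnum U 0) \<longleftrightarrow>
    ((\<lambda>e. opnorm (S e) (oper e k)) \<longlongrightarrow> 0) F"
proof -
  have "\<forall>\<^sub>F e in F. denum U (e (internal_opnorm U H (Op k))) = of_real (opnorm (S e) (oper e k))"
    using eventually_opnorm[OF k] by eventually_elim simp
  then have "((\<lambda>e. denum U (e (internal_opnorm U H (Op k)))) \<longlongrightarrow> 0) F \<longleftrightarrow>
      ((\<lambda>e. complex_of_real (opnorm (S e) (oper e k))) \<longlongrightarrow> of_real 0) F"
    unfolding of_real_0 by (rule tendsto_cong)
  then show ?thesis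
    unfolding hc_approx_cnum_iff tendsto_of_real_iff .
qed

text \<open>The difference of the operators has infinitesimal norm and representatives have finite
  norm, so the product of the two, which bounds the distance of the images, is
  infinitesimal.\<close>

lemma op_hat_cong:
  assumes "k \<in> names" "k' \<in> names"
    and "hc_approx U (internal_opnorm U H (op_diff H (Op k) (Op k'))) (cnum U 0)"
  shows "op_hat U H (Op k) = op_hat U H (Op k')"
  unfolding op_hat_def
proof (rule restrict_ext)
  obtain k'' where k'': "k'' \<in> names"
      "\<forall>\<^sub>F e in F. oper e k'' = op_diff (S e) (oper e k) (oper e k')"
    using ex_name_diff[OF assms(1,2)] by blast
  then have lim: "((\<lambda>e. opnorm (S e) (oper e k'')) \<longlongrightarrow> 0) F"
    using assms(3) op_diff_Op[OF assms(1,2) k''(2)] hc_approx_opnorm_iff[OF k''(1)] by simp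
  fix A assume "A \<in> carrier Hh"
  then obtain x where x: "x \<in> Fin" "A = vec_hat U H x" using carrier_hull by auto
  define y where "y = rep A"
  have y: "y \<in> Fin" unfolding y_def x(2)
    using near_Fin rep_vec_hat x(1) Fin_carrier by blast
  obtain B where B: "\<forall>\<^sub>F e in F. hnorm (S e) (e y) \<le> B" using y by (auto simp: Fin_def)
  have yc: "y \<in> carrier H" using y Fin_carrier by blast
  have "near (Op k y) (Op k' y)"
  proof (rule nearI)
    show "\<forall>\<^sub>F e in F. hdist (S e) (e (Op k y)) (e (Op k' y)) \<le> opnorm (S e) (oper e k'') * B"
      using eventually_hilbert eventually_Op[OF yc, of k] eventually_Op[OF yc, of k'] k''(2)
        eventually_bounded_op[OF k''(1)] B yc[unfolded carrier_iff]
    proof eventually_elim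
      case (elim e)
      interpret hilbert "S e" by fact
      have "hdist (S e) (e (Op k y)) (e (Op k' y)) = hnorm (S e) (oper e k'' (e y))"
        using elim by (simp add: hdist_def op_diff_def)
      also have "\<dots> \<le> opnorm (S e) (oper e k'') * hnorm (S e) (e y)"
        using elim by (intro opnorm_bound)
      also have "\<dots> \<le> opnorm (S e) (oper e k'') * B"
        using elim by (intro mult_left_mono opnorm_nonneg)
      finally show ?case .
    qed
    show "((\<lambda>e. opnorm (S e) (oper e k'') * B) \<longlongrightarrow> 0) F"
      using lim by (rule tendsto_mult_left_zero)
  qed (use assms yc in simp_all)
  then show "vec_hat U H (Op k (rep A)) = vec_hat U H (Op k' (rep A))"
    using assms yc by (simp add: vec_hat_eq_iff y_def)
qed

text \<open>\<open>algebra_hull\<close> applies \<open>op_hat\<close> to a chosen member of each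
  class; by \<open>op_hat_cong\<close> any member gives the same operator, so names of finite norm
  describe the whole algebra.\<close>

lemma algebra_hull_eq: "algebra_hull U H M = (\<lambda>k. op_hat U H (Op k)) ` fin_names"
proof -
  let ?hat = "hat U M (op_diff H) (internal_opnorm U H)"
  have *: "op_hat U H (rep (?hat (Op k))) = op_hat U H (Op k)" if k: "k \<in> names" for k
  proof -
    obtain k'' where k'': "k'' \<in> names"
        "\<forall>\<^sub>F e in F. oper e k'' = op_diff (S e) (oper e k) (oper e k)"
      using ex_name_diff[OF k k] by blast
    \<comment> \<open>\<open>rep\<close> is meaningful only if the class is nonempty: it contains
      \<open>Op k\<close>, since the difference of \<open>Op k\<close> with itself has norm
      0.\<close>
    have "\<forall>\<^sub>F e in F. opnorm (S e) (oper e k'') = 0"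
      using eventually_hilbert k''(2) eventually_bounded_op[OF k''(1)] eventually_bounded_op[OF k]
    proof eventually_elim
      case (elim e)
      interpret hilbert "S e" by fact
      have "opnorm (S e) (oper e k'') \<le> 0"
        using elim bounded_opsD(1)[OF elim(4)]
        by (intro opnorm_le) (simp_all add: op_diff_def a_minus_def r_neg)
      with opnorm_nonneg[OF elim(3)] show ?case by simp
    qed
    then have "((\<lambda>e. opnorm (S e) (oper e k'')) \<longlongrightarrow> 0) F"
      by (rule tendsto_eventually)
    then have "Op k \<in> ?hat (Op k)"
      using k op_diff_Op[OF k k k''(2)] hc_approx_opnorm_iff[OF k''(1)] by (simp add: hat_def M_eq)
    then have "rep (?hat (Op k)) \<in> ?hat (Op k)" by (rule rep_mem)
    then obtain k' where k': "k' \<in> names" "rep (?hat (Op k)) = Op k'"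
      "hc_approx U (internal_opnorm U H (op_diff H (Op k') (Op k))) (cnum U 0)"
      unfolding hat_def M_eq by auto
    then show ?thesis using op_hat_cong[OF k'(1) k k'(3)] by simp
  qed
  have "{T \<in> M. hc_finite U (internal_opnorm U H T)} = Op ` fin_names"
    unfolding M_eq using hc_finite_opnorm_iff fin_names_names by blast
  then show ?thesis
    unfolding algebra_hull_def nonstandard_hull_def using * fin_names_names
    by (auto simp: image_image intro!: image_cong)
qed

lemma Op_Fin:
  assumes k: "k \<in> fin_names" and x: "x \<in> Fin"
  shows "Op k x \<in> Fin"
proof -
  obtain A B where A: "\<forall>\<^sub>F e in F. hnorm (S e) (e x) \<le> A" and B: "\<forall>\<^sub>F e in F. opnorm (S e) (oper e k) \<le> B"
    using assms by (auto simp: Fin_def fin_names_def)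
  have xc: "x \<in> carrier H" and kn: "k \<in> names" using x k by (simp_all add: Fin_def fin_names_def)
  have "\<forall>\<^sub>F e in F. hnorm (S e) (e (Op k x)) \<le> B * A"
    using eventually_hilbert A B eventually_Op[OF xc, of k] eventually_bounded_op[OF kn] xc[unfolded carrier_iff]
  proof eventually_elim
    case (elim e)
    interpret hilbert "S e" by fact
    have "hnorm (S e) (e (Op k x)) \<le> opnorm (S e) (oper e k) * hnorm (S e) (e x)"
      using elim by (simp add: opnorm_bound)
    also have "\<dots> \<le> B * A"
      using elim opnorm_nonneg[OF elim(5)] by (intro mult_mono) auto
    finally show ?case .
  qed
  then show ?thesis using kn xc by (auto simp: Fin_def)
qed

lemma Op_near:
  assumes k: "k \<in> fin_names" and xy: "x \<in> carrier H" "y \<in> carrier H" "near x y"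
  shows "near (Op k x) (Op k y)"
proof -
  obtain B where B: "\<forall>\<^sub>F e in F. opnorm (S e) (oper e k) \<le> B"
    using k by (auto simp: fin_names_def)
  have kn: "k \<in> names" using k by (simp add: fin_names_def)
  show ?thesis
  proof (rule nearI)
    show "Op k x \<in> carrier H" "Op k y \<in> carrier H" using kn xy by simp_all
    show "\<forall>\<^sub>F e in F. hdist (S e) (e (Op k x)) (e (Op k y)) \<le> B * hdist (S e) (e x) (e y)"
      using eventually_hilbert B eventually_Op[OF xy(1), of k] eventually_Op[OF xy(2), of k]
        eventually_bounded_op[OF kn] xy(1,2)[unfolded carrier_iff]
    proof eventually_elim
      case (elim e)
      interpret hilbert "S e" by fact
      have "hdist (S e) (e (Op k x)) (e (Op k y)) = hnorm (S e) (oper e k (e x \<ominus>\<^bsub>S e\<^esub> e y))"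
        using elim by (simp add: hdist_def bounded_op_diff)
      also have "\<dots> \<le> opnorm (S e) (oper e k) * hdist (S e) (e x) (e y)"
        unfolding hdist_def using elim by (intro opnorm_bound) simp_all
      also have "\<dots> \<le> B * hdist (S e) (e x) (e y)"
        using elim by (intro mult_right_mono) simp_all
      finally show ?case .
    qed
    show "((\<lambda>e. B * hdist (S e) (e x) (e y)) \<longlongrightarrow> 0) F"
      using xy(3) unfolding near_def by (rule tendsto_mult_right_zero)
  qed
qed

lemma op_hat_Op:
  assumes k: "k \<in> fin_names" and x: "x \<in> Fin"
  shows "op_hat U H (Op k) (vec_hat U H x) = vec_hat U H (Op k x)"
proof -
  have xc: "x \<in> carrier H" using x Fin_carrier by blast
  have "op_hat U H (Op k) (vec_hat U H x) = vec_hat U H (Op k (rep (vec_hat U H x)))"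
    using x unfolding op_hat_def carrier_hull by simp
  also have "\<dots> = vec_hat U H (Op k x)"
    using k xc rep_vec_hat[OF xc] Op_near[OF k] fin_names_names[OF k] by (subst vec_hat_eq_iff) simp_all
  finally show ?thesis .
qed

lemma Op_add:
  assumes "k \<in> names" "x \<in> carrier H" "y \<in> carrier H"
  shows "Op k (x \<oplus>\<^bsub>H\<^esub> y) = Op k x \<oplus>\<^bsub>H\<^esub> Op k y"
  unfolding eq_iff_eventually
  using eventually_hilbert eventually_bounded_op[OF assms(1)] assms(2,3)[unfolded carrier_iff]
    eventually_Op[OF assms(2), of k] eventually_Op[OF assms(3), of k] eventually_add[of x y]
    eventually_Op[OF add_closed[OF assms(2,3)], of k] eventually_add[of "Op k x" "Op k y"]
  by eventually_elim (simp add: hilbert.bounded_opsD(2))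

lemma Op_smult:
  assumes "k \<in> names" "x \<in> carrier H"
  shows "Op k (z \<odot>\<^bsub>H\<^esub> x) = z \<odot>\<^bsub>H\<^esub> Op k x"
  unfolding eq_iff_eventually
  using eventually_hilbert eventually_bounded_op[OF assms(1)] assms(2)[unfolded carrier_iff]
    eventually_Op[OF assms(2), of k] eventually_smult[of z x]
    eventually_Op[OF smult_closed[OF assms(2)], of k z] eventually_smult[of z "Op k x"]
  by eventually_elim (simp add: hilbert.bounded_opsD(3))

end

section \<open>The strong limit of the partial sums\<close>

text \<open>A basic neighbourhood of \<open>f\<close> restricts finitely many coordinates, so an
  element of \<open>A\<close> that equals \<open>f\<close> there already lies in it: exact
  interpolation puts \<open>f\<close> into the closure.\<close>

lemma closedin_product_interpolation:
  assumes "closedin (subtopology (product_topology (\<lambda>_. X) C) B) A"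
    and "f \<in> extensional C" "f \<in> B"
    and interpolation: "\<And>W. finite W \<Longrightarrow> W \<subseteq> C \<Longrightarrow> \<exists>g\<in>A. \<forall>w\<in>W. g w = f w"
  shows "f \<in> A"
proof (rule ccontr)
  assume "f \<notin> A"
  let ?P = "product_topology (\<lambda>_. X) C" and ?T = "subtopology (product_topology (\<lambda>_. X) C) B"
  have A: "A \<subseteq> topspace ?T" using assms(1) by (rule closedin_subset)
  have A': "g w \<in> topspace X" "g \<in> B" if "g \<in> A" "w \<in> C" for g w
    using A that by (auto simp: PiE_iff)
  have gB: "g \<in> B" "g \<in> extensional C" if "g \<in> A" for g
    using A that by (auto simp: PiE_iff)
  \<comment> \<open>Interpolation at a single point shows that \<open>f\<close> takes values in
    \<open>X\<close>.\<close>
  have "f w \<in> topspace X" if "w \<in> C" for w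
    using interpolation[of "{w}"] that A' by force
  with assms(2,3) have "f \<in> topspace ?T" by (simp add: PiE_iff)
  moreover have "openin ?T (topspace ?T - A)" using assms(1) by blast
  ultimately obtain W where W: "openin ?P W" "topspace ?T - A = W \<inter> B" "f \<in> W"
    using \<open>f \<notin> A\<close> unfolding openin_subtopology by blast
  from W(1,3) obtain V where V: "finite {i \<in> C. V i \<noteq> topspace X}" "f \<in> Pi\<^sub>E C V" "Pi\<^sub>E C V \<subseteq> W"
    unfolding openin_product_topology_alt by blast
  obtain g where g: "g \<in> A" "\<forall>w\<in>{i \<in> C. V i \<noteq> topspace X}. g w = f w"
    using interpolation[OF V(1)] by blast
  have "g \<in> Pi\<^sub>E C V"
  proof (rule PiE_I)
    fix w assume w: "w \<in> C"
    show "g w \<in> V w"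
    proof (cases "V w = topspace X")
      case True
      then show ?thesis using A'(1)[OF g(1) w] by simp
    next
      case False
      then show ?thesis using g(2) w V(2) by (auto simp: PiE_iff)
    qed
  qed (use gB[OF g(1)] in \<open>auto simp: extensional_def\<close>)
  then have "g \<in> W \<inter> B" using V(3) gB[OF g(1)] by blast
  with g(1) W(2) show False by blast
qed

section \<open>The projections and their partial sums in the fibres\<close>

locale internal_projections = internal_algebra +
  fixes P :: "nat \<Rightarrow> 'b"
  assumes P_names: "P n \<in> names"
    and P_projection: "is_projection H (Op (P n))"
    and P_nonzero: "\<exists>x\<in>carrier H. Op (P n) x \<noteq> \<zero>\<^bsub>H\<^esub>"
    and P_orthogonal: "n \<noteq> m \<Longrightarrow> x \<in> carrier H \<Longrightarrow> Op (P n) (Op (P m) x) = \<zero>\<^bsub>H\<^esub>"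
begin

lemma eventually_P_projection: "\<forall>\<^sub>F e in F. is_projection (S e) (oper e (P n))"
proof -
  have "\<forall>\<^sub>F e in F. oper e (P n) (oper e (P n) (e x)) = oper e (P n) (e x)" if x: "x \<in> carrier H" for x
  proof -
    have c: "Op (P n) x \<in> carrier H" using x P_names by simp
    have "Op (P n) (Op (P n) x) = Op (P n) x" using P_projection x by (simp add: is_projection_def)
    then show ?thesis
      unfolding eq_iff_eventually[of "Op (P n) (Op (P n) x)"]
      using eventually_Op[OF x, of "P n"] eventually_Op[OF c, of "P n"] by eventually_elim simp
  qed
  then have 1: "\<forall>\<^sub>F e in F. \<forall>a\<in>carrier (S e). oper e (P n) (oper e (P n) a) = oper e (P n) a"
    using eventually_ball[of "\<lambda>a l. op (l ! 0) (l ! 1) (op (l ! 0) (l ! 1) a) = op (l ! 0) (l ! 1) a"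
      "[c, P n]"] by simp
  have "\<forall>\<^sub>F e in F. ip (S e) (oper e (P n) (e x)) (e y) = ip (S e) (e x) (oper e (P n) (e y))"
    if x: "x \<in> carrier H" and y: "y \<in> carrier H" for x y
  proof -
    have "ip H (Op (P n) x) y = ip H x (Op (P n) y)"
      using P_projection x y by (simp add: is_projection_def adjoint_pair_def)
    then show ?thesis
      unfolding eq_iff_eventually[of "ip H (Op (P n) x) y"]
      using eventually_Op[OF x, of "P n"] eventually_Op[OF y, of "P n"]
        eventually_ip[of "Op (P n) x" y] eventually_ip[of x "Op (P n) y"]
    proof eventually_elim
      case (elim e)
      then have "num U (ip (S e) (oper e (P n) (e x)) (e y)) = num U (ip (S e) (e x) (oper e (P n) (e y)))"
        by simp
      then show ?case by (rule injD[OF inj_num])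
    qed
  qed
  \<comment> \<open>The inner variable is quantified while \<open>x\<close> is still a parameter;
    the outer one follows by the same lemma.\<close>
  then have "\<forall>\<^sub>F e in F. \<forall>b\<in>carrier (S e). ip (S e) (oper e (P n) (e x)) b = ip (S e) (e x) (oper e (P n) b)"
    if x: "x \<in> carrier H" for x
    using eventually_ball[of "\<lambda>b l. ip (\<H> (l ! 0)) (op (l ! 0) (l ! 1) (l ! 2)) b =
        ip (\<H> (l ! 0)) (l ! 2) (op (l ! 0) (l ! 1) b)" "[c, P n, x]"] x by simp
  then have "\<forall>\<^sub>F e in F. \<forall>a\<in>carrier (S e). \<forall>b\<in>carrier (S e).
      ip (S e) (oper e (P n) a) b = ip (S e) a (oper e (P n) b)"
    using eventually_ball[of "\<lambda>a l. \<forall>b\<in>carrier (\<H> (l ! 0)). ip (\<H> (l ! 0)) (op (l ! 0) (l ! 1) a) b =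
        ip (\<H> (l ! 0)) a (op (l ! 0) (l ! 1) b)" "[c, P n]"] by simp
  with 1 show ?thesis
    by eventually_elim (simp add: is_projection_def adjoint_pair_def)
qed

lemma eventually_P_orthogonal:
  assumes "n \<noteq> m"
  shows "\<forall>\<^sub>F e in F. \<forall>a\<in>carrier (S e). oper e (P n) (oper e (P m) a) = \<zero>\<^bsub>S e\<^esub>"
proof -
  have "\<forall>\<^sub>F e in F. oper e (P n) (oper e (P m) (e x)) = \<zero>\<^bsub>S e\<^esub>" if x: "x \<in> carrier H" for x
  proof -
    have c: "Op (P m) x \<in> carrier H" using x P_names by simp
    have "\<forall>\<^sub>F e in F. e (Op (P n) (Op (P m) x)) = e \<zero>\<^bsub>H\<^esub>"
      using P_orthogonal[OF assms x] by simp
    then show ?thesis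
      using eventually_Op[OF x, of "P m"] eventually_Op[OF c, of "P n"] eventually_zero
      by eventually_elim simp
  qed
  then show ?thesis
    using eventually_ball[of "\<lambda>a l. op (l ! 0) (l ! 1) (op (l ! 0) (l ! 2) a) = \<zero>\<^bsub>\<H> (l ! 0)\<^esub>"
      "[c, P n, P m]"] by simp
qed

text \<open>A nonzero value of \<open>P n\<close> is eventually nonzero in the fibres; there it is
  normalised, which stays in the range, and \<open>eventually_ex\<close> makes the unit vectors
  internal.\<close>

lemma ex_unit_vector:
  "\<exists>u\<in>carrier H. (\<forall>\<^sub>F e in F. hnorm (S e) (e u) = 1) \<and> (\<forall>\<^sub>F e in F. oper e (P n) (e u) = e u)"
proof -
  obtain x where x: "x \<in> carrier H" "Op (P n) x \<noteq> \<zero>\<^bsub>H\<^esub>" using P_nonzero by blast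
  have "\<forall>\<^sub>F e in F. e (Op (P n) x) \<noteq> e \<zero>\<^bsub>H\<^esub>"
    using x(2) eventually_not_F[of "\<lambda>l. l ! 0 = l ! 1" "[Op (P n) x, \<zero>\<^bsub>H\<^esub>]"]
    unfolding eq_iff_eventually[of "Op (P n) x"] by simp
  with eventually_hilbert eventually_zero eventually_Op[OF x(1), of "P n"]
    eventually_bounded_op[OF P_names[of n]] eventually_P_projection[of n] x(1)[unfolded carrier_iff]
  have "\<forall>\<^sub>F e in F. \<exists>u. u \<in> carrier (S e) \<and> hnorm (S e) u = 1 \<and> oper e (P n) u = u"
  proof eventually_elim
    case (elim e)
    interpret hilbert "S e" by fact
    let ?v = "oper e (P n) (e x)"
    have v: "?v \<in> carrier (S e)" "?v \<noteq> \<zero>\<^bsub>S e\<^esub>" using elim bounded_opsD(1) by auto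
    then have "hnorm (S e) ?v \<noteq> 0" using hnorm_eq_zero by blast
    with v(1) have "hnorm (S e) (of_real (1 / hnorm (S e) ?v) \<odot>\<^bsub>S e\<^esub> ?v) = 1"
      by (simp add: hnorm_smult norm_divide)
    moreover have "oper e (P n) (of_real (1 / hnorm (S e) ?v) \<odot>\<^bsub>S e\<^esub> ?v) = of_real (1 / hnorm (S e) ?v) \<odot>\<^bsub>S e\<^esub> ?v"
      using elim v(1) by (simp add: bounded_opsD(3) projection_idem)
    ultimately show ?case using v(1) by blast
  qed
  then obtain u where "\<forall>\<^sub>F e in F. e u \<in> carrier (S e) \<and> hnorm (S e) (e u) = 1 \<and> oper e (P n) (e u) = e u"
    using eventually_ex[of "\<lambda>u l. u \<in> carrier (\<H> (l ! 0)) \<and> hnorm (\<H> (l ! 0)) u = 1 \<and> op (l ! 0) (l ! 1) u = u"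
      "[c, P n]"] by auto
  then show ?thesis
    by (intro bexI[of _ u]) (auto simp: carrier_iff elim: eventually_mono)
qed

text \<open>The sum of two operators has no preferred name, so each step chooses one.
  \<open>Q n\<close> names the sum of the \<open>n + 1\<close> projections up to index
  \<open>n\<close>.\<close>

primrec Q :: "nat \<Rightarrow> 'b" where
  "Q 0 = P 0"
| "Q (Suc n) = (SOME k. k \<in> names \<and>
     (\<forall>\<^sub>F e in F. \<forall>a\<in>carrier (S e). oper e k a = oper e (Q n) a \<oplus>\<^bsub>S e\<^esub> oper e (P (Suc n)) a))"

lemma Q_names: "Q n \<in> names"
  and eventually_Q_Suc:
    "\<forall>\<^sub>F e in F. \<forall>a\<in>carrier (S e). oper e (Q (Suc n)) a = oper e (Q n) a \<oplus>\<^bsub>S e\<^esub> oper e (P (Suc n)) a"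
proof -
  have *: "Q (Suc n) \<in> names \<and> (\<forall>\<^sub>F e in F. \<forall>a\<in>carrier (S e).
      oper e (Q (Suc n)) a = oper e (Q n) a \<oplus>\<^bsub>S e\<^esub> oper e (P (Suc n)) a)"
    if "Q n \<in> names" for n
    unfolding Q.simps using ex_name_add[OF that P_names[of "Suc n"]]
    by (intro someI_ex[of "\<lambda>k. k \<in> names \<and> (\<forall>\<^sub>F e in F. \<forall>a\<in>carrier (S e).
        oper e k a = oper e (Q n) a \<oplus>\<^bsub>S e\<^esub> oper e (P (Suc n)) a)"]) blast
  show "Q n \<in> names" for n
    by (induction n) (use P_names * in auto)
  with * show "\<forall>\<^sub>F e in F. \<forall>a\<in>carrier (S e).
      oper e (Q (Suc n)) a = oper e (Q n) a \<oplus>\<^bsub>S e\<^esub> oper e (P (Suc n)) a" by blast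
qed

lemma eventually_projection_sums:
  "\<forall>\<^sub>F e in F. projection_sums (S e) (\<lambda>i. oper e (P i)) (\<lambda>i. oper e (Q i)) N"
proof -
  have 1: "\<forall>\<^sub>F e in F. \<forall>i\<in>{..N}. oper e (P i) \<in> bounded_ops (S e) \<and> is_projection (S e) (oper e (P i)) \<and>
      oper e (Q i) \<in> bounded_ops (S e) \<and>
      (\<forall>a\<in>carrier (S e). oper e (Q (Suc i)) a = oper e (Q i) a \<oplus>\<^bsub>S e\<^esub> oper e (P (Suc i)) a)"
    by (intro eventually_ball_finite ballI eventually_conj eventually_bounded_op P_names Q_names
        eventually_P_projection eventually_Q_Suc) simp
  have 2: "\<forall>\<^sub>F e in F. \<forall>i\<in>{..N}. \<forall>j\<in>{..N}. i \<noteq> j \<longrightarrow>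
      (\<forall>a\<in>carrier (S e). oper e (P i) (oper e (P j) a) = \<zero>\<^bsub>S e\<^esub>)"
  proof (intro eventually_ball_finite ballI)
    fix i j
    show "\<forall>\<^sub>F e in F. i \<noteq> j \<longrightarrow> (\<forall>a\<in>carrier (S e). oper e (P i) (oper e (P j) a) = \<zero>\<^bsub>S e\<^esub>)"
      by (cases "i = j") (use eventually_P_orthogonal in simp_all)
  qed simp_all
  from eventually_hilbert 1 2 show ?thesis
  proof eventually_elim
    case (elim e)
    show ?case
      by (rule projection_sums.intro[OF elim(1)], unfold_locales) (use elim(2,3) in simp_all)
  qed
qed

section \<open>Convergence of the partial sums\<close>

text \<open>\<epsilon>, \<open>N\<close> and \<open>n\<close> are standard and stand outside;
  \<open>F\<close> judges one inequality at a time. So \<open>y\<close> matters only up to infinite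
  closeness, and its class is the limit in the hull.\<close>

definition is_lim :: "'b \<Rightarrow> 'b \<Rightarrow> bool" where
  "is_lim x y \<longleftrightarrow> (\<forall>\<epsilon>>0. \<exists>N. \<forall>n\<ge>N. \<forall>\<^sub>F e in F. hdist (S e) (oper e (Q n) (e x)) (e y) < \<epsilon>)"

text \<open>The standard parts \<open>s n\<close> of the squared norms increase by Pythagoras and
  are bounded by \<open>B\<^sup>2\<close>, so they converge; their differences are the standard
  parts of the squared distances.\<close>

lemma Q_Cauchy:
  assumes x: "x \<in> Fin" and "\<epsilon> > 0"
  shows "\<exists>N. \<forall>m\<ge>N. \<forall>n\<ge>N. \<forall>\<^sub>F e in F. hdist (S e) (oper e (Q n) (e x)) (oper e (Q m) (e x)) < \<epsilon>"
proof -
  have xc: "x \<in> carrier H" using x Fin_carrier by blast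
  obtain B where B: "\<forall>\<^sub>F e in F. hnorm (S e) (e x) \<le> B" using x by (auto simp: Fin_def)
  let ?q = "\<lambda>n e. (hnorm (S e) (oper e (Q n) (e x)))\<^sup>2"
  have bound: "\<forall>\<^sub>F e in F. ?q n e \<le> B\<^sup>2" for n
    using eventually_projection_sums[of n] B xc[unfolded carrier_iff]
  proof eventually_elim
    case (elim e)
    interpret projection_sums "S e" "\<lambda>i. oper e (P i)" "\<lambda>i. oper e (Q i)" n by fact
    have "hnorm (S e) (oper e (Q n) (e x)) \<le> hnorm (S e) (e x)"
      by (rule projection_contraction[OF Q Q_projection]) (use elim in simp_all)
    with elim show ?case by (intro power_mono) simp_all
  qed
  have "\<exists>s. (?q n \<longlongrightarrow> s) F" for n
  proof -
    \<comment> \<open>Read as complex numbers, because \<open>internal_tendsto\<close> provides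
      limits of complex values.\<close>
    have "\<forall>\<^sub>F e in F. cmod (of_real (?q n e)) \<le> B\<^sup>2"
      using bound[of n] by (rule eventually_mono) (simp add: norm_power)
    then obtain w where "((\<lambda>e. of_real (?q n e) :: complex) \<longlongrightarrow> w) F"
      using internal_tendsto[of "\<lambda>l. of_real ((hnorm (\<H> (l ! 0)) (op (l ! 0) (l ! 1) (l ! 2)))\<^sup>2)" "[c, Q n, x]"]
      by auto
    from tendsto_Re[OF this] show ?thesis by auto
  qed
  then have "\<exists>s. \<forall>n. (?q n \<longlongrightarrow> s n) F" by (intro choice allI)
  then obtain s where s: "\<And>n. (?q n \<longlongrightarrow> s n) F" by blast
  have dist: "\<forall>\<^sub>F e in F. (hdist (S e) (oper e (Q n) (e x)) (oper e (Q m) (e x)))\<^sup>2 = ?q n e - ?q m e"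
    if "m \<le> n" for m n
    using eventually_projection_sums[of n] xc[unfolded carrier_iff]
  proof eventually_elim
    case (elim e)
    interpret projection_sums "S e" "\<lambda>i. oper e (P i)" "\<lambda>i. oper e (Q i)" n by fact
    from elim that show ?case by (intro Q_hdist) simp_all
  qed
  have "incseq s"
  proof (rule incseq_SucI)
    fix n
    have "\<forall>\<^sub>F e in F. ?q n e \<le> ?q (Suc n) e"
      using dist[of n "Suc n", OF le_SucI[OF order_refl]]
    proof (rule eventually_mono)
      fix e assume "(hdist (S e) (oper e (Q (Suc n)) (e x)) (oper e (Q n) (e x)))\<^sup>2 = ?q (Suc n) e - ?q n e"
      then show "?q n e \<le> ?q (Suc n) e"
        using zero_le_power2[of "hdist (S e) (oper e (Q (Suc n)) (e x)) (oper e (Q n) (e x))"] by linarith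
    qed
    then show "s n \<le> s (Suc n)"
      by (rule tendsto_le[OF F_neq_bot s s])
  qed
  moreover have "s n \<le> B\<^sup>2" for n
    using tendsto_upperbound[OF s bound F_neq_bot] .
  ultimately obtain L where L: "s \<longlonglongrightarrow> L" "\<And>n. s n \<le> L"
    using incseq_convergent[of s "B\<^sup>2"] by blast
  \<comment> \<open>\<epsilon> is squared because the differences of the \<open>s n\<close> measure
    squared distances.\<close>
  have "\<forall>\<^sub>F n in sequentially. L - \<epsilon>\<^sup>2 < s n"
    using L(1) by (rule order_tendstoD) (use \<open>\<epsilon> > 0\<close> in simp)
  then obtain N where N: "\<And>n. n \<ge> N \<Longrightarrow> L - \<epsilon>\<^sup>2 < s n"
    unfolding eventually_sequentially by blast
  have main: "\<forall>\<^sub>F e in F. hdist (S e) (oper e (Q n) (e x)) (oper e (Q m) (e x)) < \<epsilon>"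
    if "N \<le> m" "m \<le> n" for m n
  proof -
    have "s n - s m < \<epsilon>\<^sup>2" using L(2)[of n] N[OF that(1)] by simp
    then have "\<forall>\<^sub>F e in F. ?q n e - ?q m e < \<epsilon>\<^sup>2"
      by (intro order_tendstoD(2)[OF tendsto_diff[OF s s]])
    with dist[OF that(2)] show ?thesis
    proof eventually_elim
      case (elim e)
      then show ?case using \<open>\<epsilon> > 0\<close> by (intro power_less_imp_less_base[of _ 2 \<epsilon>]) simp_all
    qed
  qed
  show ?thesis
  proof (intro exI[of _ N] allI impI)
    fix m n assume "N \<le> m" "N \<le> n"
    show "\<forall>\<^sub>F e in F. hdist (S e) (oper e (Q n) (e x)) (oper e (Q m) (e x)) < \<epsilon>"
    proof (cases "m \<le> n")
      case True
      then show ?thesis using main \<open>N \<le> m\<close> by blast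
    next
      case False
      then have "\<forall>\<^sub>F e in F. hdist (S e) (oper e (Q m) (e x)) (oper e (Q n) (e x)) < \<epsilon>"
        using main \<open>N \<le> n\<close> by simp
      then show ?thesis
        using eventually_hilbert eventually_bounded_op[OF Q_names[of n]]
          eventually_bounded_op[OF Q_names[of m]] xc[unfolded carrier_iff]
        by eventually_elim (simp add: hilbert.hdist_commute hilbert.bounded_opsD(1))
    qed
  qed
qed

text \<open>The condition of index \<open>i\<close> asks for a named contraction within
  \<open>1 / Suc i\<close> of \<open>Q (N i)\<close> on all of \<open>xs\<close>; a late partial sum
  meets finitely many conditions, saturation meets them all.\<close>

lemma ex_interpolation:
  assumes xs: "set xs \<subseteq> Fin"
  shows "\<exists>k\<in>names. (\<forall>\<^sub>F e in F. opnorm (S e) (oper e k) \<le> 1) \<and> (\<forall>x\<in>set xs. is_lim x (Op k x))"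
proof -
  define C where "C i x m n \<longleftrightarrow> (\<forall>\<^sub>F e in F.
      hdist (S e) (oper e (Q n) (e x)) (oper e (Q m) (e x)) < 1 / Suc i)" for i x m n
  have "\<exists>N. \<forall>x\<in>set xs. \<forall>m\<ge>N. \<forall>n\<ge>N. C i x m n" for i
  proof -
    have "\<forall>x\<in>set xs. \<exists>N. \<forall>m\<ge>N. \<forall>n\<ge>N. C i x m n"
      unfolding C_def using xs by (intro ballI Q_Cauchy) auto
    then obtain f where f: "\<And>x m n. \<lbrakk>x \<in> set xs; m \<ge> f x; n \<ge> f x\<rbrakk> \<Longrightarrow> C i x m n" by metis
    \<comment> \<open>If \<open>xs\<close> is empty, \<open>Max\<close> is an arbitrary number and
      the claim is vacuous.\<close>
    have "f x \<le> Max (f ` set xs)" if "x \<in> set xs" for x using that by simp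
    with f show ?thesis
      by (intro exI[of _ "Max (f ` set xs)"] ballI allI impI) (meson order_trans)
  qed
  then obtain N where "\<And>i x m n. \<lbrakk>x \<in> set xs; m \<ge> N i; n \<ge> N i\<rbrakk> \<Longrightarrow> C i x m n" by metis
  note N = this[unfolded C_def]
  \<comment> \<open>The parameters are \<open>c\<close>, \<open>Q (N i)\<close> and then all the
    vectors; a relation takes finitely many parameters, whence a list \<open>xs\<close>.\<close>
  let ?R = "\<lambda>i b l. b \<in> K (hd l) \<and> opnorm (\<H> (hd l)) (op (hd l) b) \<le> 1 \<and>
    (\<forall>a\<in>set (tl (tl l)). hdist (\<H> (hd l)) (op (hd l) b a) (op (hd l) (hd (tl l)) a) < 1 / Suc i)"
  have "\<exists>k. \<forall>i. \<forall>\<^sub>F e in F. ?R i (e k) (map e (c # Q (N i) # xs))"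
  proof (rule saturation)
    fix n
    \<comment> \<open>Beyond every threshold of index at most \<open>n\<close>, so one partial sum
      serves all these \<open>i\<close>.\<close>
    let ?m = "Max (N ` {..n})"
    show "\<exists>k. \<forall>i\<le>n. \<forall>\<^sub>F e in F. ?R i (e k) (map e (c # Q (N i) # xs))"
    proof (intro exI[of _ "Q ?m"] allI impI)
      fix i assume "i \<le> n"
      then have "N i \<le> ?m" by simp
      then have 1: "\<forall>\<^sub>F e in F. \<forall>x\<in>set xs.
          hdist (S e) (oper e (Q ?m) (e x)) (oper e (Q (N i)) (e x)) < 1 / Suc i"
        using N by (intro eventually_ball_finite) auto
      have 2: "\<forall>\<^sub>F e in F. opnorm (S e) (oper e (Q ?m)) \<le> 1"
        using eventually_projection_sums[of ?m]
      proof eventually_elim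
        case (elim e)
        interpret projection_sums "S e" "\<lambda>i. oper e (P i)" "\<lambda>i. oper e (Q i)" ?m by fact
        show ?case
          by (rule opnorm_le) (simp_all add: projection_contraction Q Q_projection)
      qed
      from 1 2 eventually_names[OF Q_names[of ?m]]
      show "\<forall>\<^sub>F e in F. ?R i (e (Q ?m)) (map e (c # Q (N i) # xs))"
        by eventually_elim simp
    qed
  qed
  then obtain k where k: "\<And>i. \<forall>\<^sub>F e in F. ?R i (e k) (map e (c # Q (N i) # xs))" by blast
  have kn: "k \<in> names"
    unfolding names_def using k[of 0] by (auto elim: eventually_mono)
  moreover have "\<forall>\<^sub>F e in F. opnorm (S e) (oper e k) \<le> 1"
    using k[of 0] by (auto elim: eventually_mono)
  moreover have "is_lim x (Op k x)" if x: "x \<in> set xs" for x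
    unfolding is_lim_def
  proof (intro allI impI)
    fix \<epsilon> :: real assume "\<epsilon> > 0"
    \<comment> \<open>Half of \<epsilon> for each side of the detour through
      \<open>Q (N i)\<close>.\<close>
    then obtain i where i: "1 / Suc i < \<epsilon> / 2"
      by (metis nat_approx_posE half_gt_zero)
    have xc: "x \<in> carrier H" using x xs Fin_carrier by blast
    show "\<exists>N. \<forall>n\<ge>N. \<forall>\<^sub>F e in F. hdist (S e) (oper e (Q n) (e x)) (e (Op k x)) < \<epsilon>"
    proof (intro exI[of _ "N i"] allI impI)
      fix n assume n: "N i \<le> n"
      from eventually_hilbert eventually_bounded_op[OF Q_names[of n]] eventually_bounded_op[OF kn]
        eventually_bounded_op[OF Q_names[of "N i"]] xc[unfolded carrier_iff]
        N[OF x order_refl n] k[of i] eventually_Op[OF xc, of k]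
      show "\<forall>\<^sub>F e in F. hdist (S e) (oper e (Q n) (e x)) (e (Op k x)) < \<epsilon>"
      proof eventually_elim
        case (elim e)
        interpret hilbert "S e" by fact
        have c: "oper e (Q n) (e x) \<in> carrier (S e)" "oper e k (e x) \<in> carrier (S e)"
          "oper e (Q (N i)) (e x) \<in> carrier (S e)"
          using elim bounded_opsD(1) by blast+
        have "hdist (S e) (oper e k (e x)) (oper e (Q (N i)) (e x)) < 1 / Suc i"
          using elim(7) x by simp
        with elim(6) i have "hdist (S e) (oper e (Q n) (e x)) (oper e (Q (N i)) (e x)) +
            hdist (S e) (oper e (Q (N i)) (e x)) (oper e k (e x)) < \<epsilon>"
          using hdist_commute[OF c(2,3)] by simp
        then show ?case
          using hdist_triangle[OF c(1,3,2)] elim(8) by simp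
      qed
    qed
  qed
  ultimately show ?thesis by blast
qed

text \<open>Partial sums are contractions, so close vectors have close limits; for
  \<open>x = x'\<close> this is uniqueness of the limit up to infinite closeness. The distance is
  split at the two values of one late partial sum.\<close>

lemma is_lim_near:
  assumes c: "x \<in> carrier H" "x' \<in> carrier H" "y \<in> carrier H" "y' \<in> carrier H"
    and lim: "is_lim x y" "is_lim x' y'" and near: "near x x'"
  shows "near y y'"
  unfolding near_def
proof (rule tendstoI)
  fix \<epsilon> :: real assume "\<epsilon> > 0"
  then have e3: "\<epsilon> / 3 > 0" by simp
  obtain N where N: "\<And>n. n \<ge> N \<Longrightarrow> \<forall>\<^sub>F e in F. hdist (S e) (oper e (Q n) (e x)) (e y) < \<epsilon> / 3"
    using lim(1) e3 unfolding is_lim_def by meson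
  obtain N' where N': "\<And>n. n \<ge> N' \<Longrightarrow> \<forall>\<^sub>F e in F. hdist (S e) (oper e (Q n) (e x')) (e y') < \<epsilon> / 3"
    using lim(2) e3 unfolding is_lim_def by meson
  let ?n = "max N N'"
  have "\<forall>\<^sub>F e in F. hdist (S e) (e x) (e x') < \<epsilon> / 3"
    using near e3 unfolding near_def by (rule order_tendstoD)
  with eventually_projection_sums[of ?n] N[of ?n, simplified] N'[of ?n, simplified]
    c[unfolded carrier_iff]
  show "\<forall>\<^sub>F e in F. dist (hdist (S e) (e y) (e y')) 0 < \<epsilon>"
  proof eventually_elim
    case (elim e)
    interpret projection_sums "S e" "\<lambda>i. oper e (P i)" "\<lambda>i. oper e (Q i)" ?n by fact
    let ?q = "oper e (Q ?n)"
    have c: "?q (e x) \<in> carrier (S e)" "?q (e x') \<in> carrier (S e)" using elim by simp_all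
    have "hdist (S e) (?q (e x)) (?q (e x')) = hnorm (S e) (?q (e x \<ominus>\<^bsub>S e\<^esub> e x'))"
      using elim Q[of ?n] by (simp add: hdist_def bounded_op_diff)
    also have "\<dots> \<le> hdist (S e) (e x) (e x')"
      unfolding hdist_def
      by (rule projection_contraction[OF Q Q_projection]) (use elim in simp_all)
    finally have "hdist (S e) (?q (e x)) (?q (e x')) < \<epsilon> / 3" using elim by simp
    moreover have "hdist (S e) (e y) (e y') \<le> hdist (S e) (e y) (?q (e x)) +
        (hdist (S e) (?q (e x)) (?q (e x')) + hdist (S e) (?q (e x')) (e y'))"
      using hdist_triangle[of "e y" "?q (e x)" "e y'"] hdist_triangle[of "?q (e x)" "?q (e x')" "e y'"]
        c elim by simp
    moreover have "hdist (S e) (e y) (?q (e x)) < \<epsilon> / 3"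
      using elim c by (simp add: hdist_commute)
    ultimately have "hdist (S e) (e y) (e y') < \<epsilon>" using elim by simp
    then show ?case using elim by (simp add: dist_real_def)
  qed
qed

text \<open>The strong limit of the partial sums of the projections on the hull.\<close>

definition Pop :: "'b set \<Rightarrow> 'b set" where
  "Pop = restrict (\<lambda>v. vec_hat U H (SOME y. y \<in> carrier H \<and> is_lim (rep v) y)) (carrier Hh)"

text \<open>Frees \<open>Pop\<close> from both of its choices: \<open>ex_interpolation\<close> for
  the single vector \<open>?r\<close> shows that some limit exists, and \<open>is_lim_near\<close>
  that neither the representative nor the limit chosen matters.\<close>

lemma Pop_eq:
  assumes x: "x \<in> Fin" and y: "y \<in> carrier H" "is_lim x y"
  shows "Pop (vec_hat U H x) = vec_hat U H y"
proof -
  let ?r = "rep (vec_hat U H x)"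
  have xc: "x \<in> carrier H" using x Fin_carrier by blast
  have r: "?r \<in> Fin" using near_Fin rep_vec_hat x xc by blast
  obtain k where "k \<in> names" "is_lim ?r (Op k ?r)"
    using ex_interpolation[of "[?r]"] r by auto
  then have "Op k ?r \<in> carrier H \<and> is_lim ?r (Op k ?r)" using r Fin_carrier by simp
  then have z: "(SOME y. y \<in> carrier H \<and> is_lim ?r y) \<in> carrier H \<and>
      is_lim ?r (SOME y. y \<in> carrier H \<and> is_lim ?r y)"
    by (rule someI[of "\<lambda>y. y \<in> carrier H \<and> is_lim ?r y"])
  then have "near (SOME y. y \<in> carrier H \<and> is_lim ?r y) y"
    using is_lim_near[of ?r x _ y] rep_vec_hat[OF xc] xc y by blast
  then show ?thesis
    unfolding Pop_def carrier_hull using x y z by (simp add: vec_hat_eq_iff)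
qed

text \<open>Supplies the approximation needed for the strong closure, and also lets
  \<open>Pop\<close> inherit properties that involve finitely many vectors.\<close>

lemma Pop_interpolation:
  assumes "finite W" "W \<subseteq> carrier Hh"
  shows "\<exists>k\<in>fin_names. (\<forall>\<^sub>F e in F. opnorm (S e) (oper e k) \<le> 1) \<and> (\<forall>v\<in>W. op_hat U H (Op k) v = Pop v)"
proof -
  obtain X where X: "finite X" "X \<subseteq> Fin" "W = vec_hat U H ` X"
    using finite_subset_image[of W "vec_hat U H" Fin] assms unfolding carrier_hull by blast
  obtain xs where xs: "set xs = X" using X(1) finite_list by blast
  obtain k where k: "k \<in> names" "\<forall>\<^sub>F e in F. opnorm (S e) (oper e k) \<le> 1" "\<forall>x\<in>X. is_lim x (Op k x)"
    using ex_interpolation[of xs] X(2) unfolding xs by blast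
  then have kf: "k \<in> fin_names" by (auto simp: fin_names_def)
  have "op_hat U H (Op k) (vec_hat U H x) = Pop (vec_hat U H x)" if "x \<in> X" for x
  proof -
    have x: "x \<in> Fin" using that X by blast
    show ?thesis
      using k that by (simp add: op_hat_Op[OF kf x] Pop_eq[OF x, of "Op k x"] Fin_carrier[OF x])
  qed
  with k kf show ?thesis unfolding X(3) by blast
qed

lemma op_hat_norm:
  assumes k: "k \<in> fin_names" "\<forall>\<^sub>F e in F. opnorm (S e) (oper e k) \<le> 1" and v: "v \<in> carrier Hh"
  shows "op_hat U H (Op k) v \<in> carrier Hh" "hnorm Hh (op_hat U H (Op k) v) \<le> hnorm Hh v"
proof -
  obtain x where x: "x \<in> Fin" "v = vec_hat U H x" using v carrier_hull by auto
  let ?r = "rep (vec_hat U H x)"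
  have xc: "x \<in> carrier H" using x Fin_carrier by blast
  have r: "?r \<in> Fin" "?r \<in> carrier H" "vec_hat U H ?r = v"
    using near_Fin rep_vec_hat x xc vec_hat_eq_iff by blast+
  let ?y = "Op k ?r"
  have y: "?y \<in> Fin" "?y \<in> carrier H" using Op_Fin[OF k(1) r(1)] Fin_carrier by blast+
  have eq: "op_hat U H (Op k) v = vec_hat U H ?y" using op_hat_Op[OF k(1) r(1)] r(3) by simp
  show "op_hat U H (Op k) v \<in> carrier Hh" unfolding eq carrier_hull using y by blast
  let ?s = "rep (vec_hat U H ?y)"
  have s: "?s \<in> carrier H" "near ?s ?y" using rep_vec_hat y by blast+
  have "((\<lambda>e. hnorm (S e) (e ?r)) \<longlongrightarrow> hnorm Hh v) F"
    using tendsto_hnorm_hull[OF x(1)] x(2) by simp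
  \<comment> \<open>The hull norm is read off at the representative \<open>?s\<close> of the image,
    whose distance to \<open>?y\<close> is infinitesimal.\<close>
  moreover have "((\<lambda>e. hnorm (S e) (e ?s) - hdist (S e) (e ?s) (e ?y)) \<longlongrightarrow> hnorm Hh (vec_hat U H ?y) - 0) F"
    using tendsto_diff[OF tendsto_hnorm_hull[OF y(1)] s(2)[unfolded near_def]] .
  moreover have "\<forall>\<^sub>F e in F. hnorm (S e) (e ?s) - hdist (S e) (e ?s) (e ?y) \<le> hnorm (S e) (e ?r)"
    using eventually_hilbert eventually_bounded_op[OF fin_names_names[OF k(1)]] k(2)
      eventually_Op[OF r(2), of k] r(2)[unfolded carrier_iff] s(1)[unfolded carrier_iff]
      y(2)[unfolded carrier_iff]
  proof eventually_elim
    case (elim e)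
    interpret hilbert "S e" by fact
    have "hnorm (S e) (e ?y) \<le> opnorm (S e) (oper e k) * hnorm (S e) (e ?r)"
      using elim by (simp add: opnorm_bound)
    also have "\<dots> \<le> 1 * hnorm (S e) (e ?r)"
      using elim by (intro mult_right_mono) simp_all
    finally show ?case
      using hnorm_le_hdist[OF elim(6,7)] by simp
  qed
  ultimately have "hnorm Hh (vec_hat U H ?y) - 0 \<le> hnorm Hh v"
    by (rule tendsto_le[OF F_neq_bot])
  then show "hnorm Hh (op_hat U H (Op k) v) \<le> hnorm Hh v" by (simp add: eq)
qed

lemma op_hat_linear:
  assumes k: "k \<in> fin_names" and v: "v \<in> carrier Hh" and w: "w \<in> carrier Hh"
  shows "op_hat U H (Op k) (v \<oplus>\<^bsub>Hh\<^esub> w) = op_hat U H (Op k) v \<oplus>\<^bsub>Hh\<^esub> op_hat U H (Op k) w"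
    and "op_hat U H (Op k) (z \<odot>\<^bsub>Hh\<^esub> v) = z \<odot>\<^bsub>Hh\<^esub> op_hat U H (Op k) v"
    and "v \<oplus>\<^bsub>Hh\<^esub> w \<in> carrier Hh" "z \<odot>\<^bsub>Hh\<^esub> v \<in> carrier Hh"
proof -
  obtain x y where x: "x \<in> Fin" "v = vec_hat U H x" and y: "y \<in> Fin" "w = vec_hat U H y"
    using v w carrier_hull by auto
  note c = Fin_carrier[OF x(1)] Fin_carrier[OF y(1)] and n = fin_names_names[OF k]
  show "op_hat U H (Op k) (v \<oplus>\<^bsub>Hh\<^esub> w) = op_hat U H (Op k) v \<oplus>\<^bsub>Hh\<^esub> op_hat U H (Op k) w"
    using c n by (simp add: x(2) y(2) hull_add op_hat_Op[OF k] x(1) y(1) add_Fin Op_add)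
  show "op_hat U H (Op k) (z \<odot>\<^bsub>Hh\<^esub> v) = z \<odot>\<^bsub>Hh\<^esub> op_hat U H (Op k) v"
    using c n by (simp add: x(2) hull_smult op_hat_Op[OF k] x(1) smult_Fin Op_smult)
  show "v \<oplus>\<^bsub>Hh\<^esub> w \<in> carrier Hh" "z \<odot>\<^bsub>Hh\<^esub> v \<in> carrier Hh"
    unfolding carrier_hull x(2) y(2) using c x y by (simp_all add: hull_add hull_smult add_Fin smult_Fin)
qed

text \<open>Linearity involves four vectors and the bound one, so both are inherited from
  contractions that interpolate \<open>Pop\<close> there.\<close>

lemma Pop_bounded_op: "Pop \<in> bounded_ops Hh"
proof -
  have ext: "Pop \<in> extensional (carrier Hh)" by (simp add: Pop_def)
  have closed: "Pop v \<in> carrier Hh" "hnorm Hh (Pop v) \<le> 1 * hnorm Hh v" if v: "v \<in> carrier Hh" for v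
  proof -
    obtain k where k: "k \<in> fin_names" "\<forall>\<^sub>F e in F. opnorm (S e) (oper e k) \<le> 1" "op_hat U H (Op k) v = Pop v"
      using Pop_interpolation[of "{v}"] v by auto
    show "Pop v \<in> carrier Hh" "hnorm Hh (Pop v) \<le> 1 * hnorm Hh v"
      using op_hat_norm[OF k(1,2) v] by (simp_all add: k(3))
  qed
  have "Pop (v \<oplus>\<^bsub>Hh\<^esub> w) = Pop v \<oplus>\<^bsub>Hh\<^esub> Pop w \<and> Pop (z \<odot>\<^bsub>Hh\<^esub> v) = z \<odot>\<^bsub>Hh\<^esub> Pop v"
    if v: "v \<in> carrier Hh" and w: "w \<in> carrier Hh" for v w z
  proof -
    \<comment> \<open>The closure statements for the hull are stated along with a name of finite
      norm; interpolation at no point provides one.\<close>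
    obtain k0 where "k0 \<in> fin_names" using Pop_interpolation[of "{}"] by auto
    note 1 = op_hat_linear(3,4)[OF this v w]
    obtain k where k: "k \<in> fin_names"
      "\<forall>u\<in>{v, w, v \<oplus>\<^bsub>Hh\<^esub> w, z \<odot>\<^bsub>Hh\<^esub> v}. op_hat U H (Op k) u = Pop u"
      using Pop_interpolation[of "{v, w, v \<oplus>\<^bsub>Hh\<^esub> w, z \<odot>\<^bsub>Hh\<^esub> v}"] v w 1 by blast
    have "op_hat U H (Op k) v = Pop v" "op_hat U H (Op k) w = Pop w"
      "op_hat U H (Op k) (v \<oplus>\<^bsub>Hh\<^esub> w) = Pop (v \<oplus>\<^bsub>Hh\<^esub> w)"
      "op_hat U H (Op k) (z \<odot>\<^bsub>Hh\<^esub> v) = Pop (z \<odot>\<^bsub>Hh\<^esub> v)"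
      using k(2) by blast+
    then show ?thesis using op_hat_linear(1,2)[OF k(1) v w] by metis
  qed
  then show ?thesis
    unfolding bounded_ops_def using ext closed by (auto simp: PiE_iff intro!: exI[of _ 1])
qed

section \<open>The strong limit is not in the hull of the algebra\<close>

lemma Pop_notin_algebra_hull: "Pop \<notin> algebra_hull U H M"
proof
  assume "Pop \<in> algebra_hull U H M"
  then obtain a where a: "a \<in> fin_names" "Pop = op_hat U H (Op a)"
    unfolding algebra_hull_eq by blast
  have an: "a \<in> names" using a fin_names_names by blast
  have "\<forall>n. \<exists>u. u \<in> carrier H \<and> (\<forall>\<^sub>F e in F. hnorm (S e) (e u) = 1) \<and> (\<forall>\<^sub>F e in F. oper e (P n) (e u) = e u)"
    using ex_unit_vector by blast
  from choice[OF this] obtain u where u': "\<forall>n. u n \<in> carrier H \<and>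
      (\<forall>\<^sub>F e in F. hnorm (S e) (e (u n)) = 1) \<and> (\<forall>\<^sub>F e in F. oper e (P n) (e (u n)) = e (u n))" ..
  have u: "u n \<in> carrier H" "\<forall>\<^sub>F e in F. hnorm (S e) (e (u n)) = 1"
    "\<forall>\<^sub>F e in F. oper e (P n) (e (u n)) = e (u n)" for n
    using u' by simp_all
  have near_u: "near (Op a (u n)) (u n)" for n
  proof -
    \<comment> \<open>\<open>Q m\<close> fixes \<open>u n\<close> as soon as
      \<open>m \<ge> n\<close>, because \<open>u n\<close> lies in the range of the summand
      \<open>P n\<close>.\<close>
    have "is_lim (u n) (u n)"
      unfolding is_lim_def
    proof (intro allI impI exI[of _ n])
      fix \<epsilon> :: real and m assume "\<epsilon> > 0" "n \<le> m"
      from eventually_projection_sums[of m] u(1)[of n, unfolded carrier_iff] u(3)[of n]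
      show "\<forall>\<^sub>F e in F. hdist (S e) (oper e (Q m) (e (u n))) (e (u n)) < \<epsilon>"
      proof eventually_elim
        case (elim e)
        interpret projection_sums "S e" "\<lambda>i. oper e (P i)" "\<lambda>i. oper e (Q i)" m by fact
        have "oper e (Q m) (oper e (P n) (e (u n))) = oper e (P n) (e (u n))"
          using Q_P[of m n "e (u n)"] elim \<open>n \<le> m\<close> by simp
        then show ?case using elim \<open>\<epsilon> > 0\<close> by simp
      qed
    qed
    moreover have uF: "u n \<in> Fin"
      unfolding Fin_def using u(1)[of n] u(2)[of n] by (auto elim!: eventually_mono intro!: exI[of _ 1])
    ultimately have "Pop (vec_hat U H (u n)) = vec_hat U H (u n)" using Pop_eq u(1) by blast
    then have "vec_hat U H (Op a (u n)) = vec_hat U H (u n)"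
      using op_hat_Op[OF a(1) uF] a(2) by simp
    then show ?thesis using u(1) an by (simp add: vec_hat_eq_iff)
  qed
  \<comment> \<open>Infinite closeness is not an internal condition, so it is split into the
    tolerances \<open>1 / Suc i\<close>; annihilation by \<open>P i\<close> is attached to the same
    index.\<close>
  let ?R = "\<lambda>i b l. b \<in> carrier (\<H> (l ! 0)) \<and> hnorm (\<H> (l ! 0)) b = 1 \<and>
    hdist (\<H> (l ! 0)) (op (l ! 0) (l ! 1) b) b < 1 / Suc i \<and> op (l ! 0) (l ! 2) b = \<zero>\<^bsub>\<H> (l ! 0)\<^esub>"
  have "\<exists>r. \<forall>i. \<forall>\<^sub>F e in F. ?R i (e r) (map e [c, a, P i])"
  proof (rule saturation)
    fix n
    show "\<exists>r. \<forall>i\<le>n. \<forall>\<^sub>F e in F. ?R i (e r) (map e [c, a, P i])"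
    \<comment> \<open>\<open>u (Suc n)\<close> is infinitely close to its image under
      \<open>a\<close>, so it meets every tolerance, and its index differs from \<open>0\<close>,
      ..., \<open>n\<close>, so these projections annihilate it.\<close>
    proof (intro exI[of _ "u (Suc n)"] allI impI)
      fix i assume "i \<le> n"
      then have "i \<noteq> Suc n" by simp
      have "\<forall>\<^sub>F e in F. hdist (S e) (e (Op a (u (Suc n)))) (e (u (Suc n))) < 1 / Suc i"
        using near_u unfolding near_def by (rule order_tendstoD) simp
      with eventually_P_orthogonal[OF \<open>i \<noteq> Suc n\<close>] u(1)[of "Suc n", unfolded carrier_iff] u(2,3)[of "Suc n"]
        eventually_Op[OF u(1)[of "Suc n"], of a]
      show "\<forall>\<^sub>F e in F. ?R i (e (u (Suc n))) (map e [c, a, P i])"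
      proof eventually_elim
        case (elim e)
        have "oper e (P i) (oper e (P (Suc n)) (e (u (Suc n)))) = \<zero>\<^bsub>S e\<^esub>"
          using elim by blast
        with elim show ?case by simp
      qed
    qed
  qed
  then obtain r where "\<And>i. \<forall>\<^sub>F e in F. ?R i (e r) (map e [c, a, P i])" by blast
  then have r: "\<And>i. \<forall>\<^sub>F e in F. e r \<in> carrier (S e) \<and> hnorm (S e) (e r) = 1 \<and>
      hdist (S e) (oper e a (e r)) (e r) < 1 / Suc i \<and> oper e (P i) (e r) = \<zero>\<^bsub>S e\<^esub>" by simp
  have rc: "r \<in> carrier H" unfolding carrier_iff using r[of 0] by (rule eventually_mono) simp
  have rF: "r \<in> Fin"
    unfolding Fin_def using rc r[of 0] by (auto elim!: eventually_mono intro!: exI[of _ 1])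
  \<comment> \<open>All \<open>Q m r\<close> with standard \<open>m\<close> vanish exactly, so the
    threshold 0 works for every \<epsilon>.\<close>
  have "is_lim r \<zero>\<^bsub>H\<^esub>"
    unfolding is_lim_def
  proof (intro allI impI exI[of _ 0])
    fix \<epsilon> :: real and m :: nat assume "\<epsilon> > 0"
    have "\<forall>\<^sub>F e in F. \<forall>i\<in>{..m}. oper e (P i) (e r) = \<zero>\<^bsub>S e\<^esub>"
    proof (intro eventually_ball_finite ballI)
      show "\<forall>\<^sub>F e in F. oper e (P i) (e r) = \<zero>\<^bsub>S e\<^esub>" for i
        using r[of i] by (rule eventually_mono) simp
    qed simp
    with eventually_projection_sums[of m] rc[unfolded carrier_iff] eventually_zero
    show "\<forall>\<^sub>F e in F. hdist (S e) (oper e (Q m) (e r)) (e \<zero>\<^bsub>H\<^esub>) < \<epsilon>"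
    proof eventually_elim
      case (elim e)
      interpret projection_sums "S e" "\<lambda>i. oper e (P i)" "\<lambda>i. oper e (Q i)" m by fact
      have "oper e (Q m) (e r) = \<zero>\<^bsub>S e\<^esub>" using elim by (intro Q_eq_zero) simp_all
      then show ?case using elim \<open>\<epsilon> > 0\<close> by simp
    qed
  qed
  then have "Pop (vec_hat U H r) = vec_hat U H \<zero>\<^bsub>H\<^esub>"
    using Pop_eq rF zero_closed by blast
  then have "vec_hat U H (Op a r) = vec_hat U H \<zero>\<^bsub>H\<^esub>"
    using op_hat_Op[OF a(1) rF] a(2) by simp
  then have "near (Op a r) \<zero>\<^bsub>H\<^esub>" using rc an by (simp add: vec_hat_eq_iff)
  \<comment> \<open>The condition of index 1 puts the image of \<open>r\<close> within 1/2 of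
    \<open>r\<close>; together with this bound the norm of \<open>r\<close> would be below
    1.\<close>
  then have "\<forall>\<^sub>F e in F. hdist (S e) (e (Op a r)) (e \<zero>\<^bsub>H\<^esub>) < 1 / 2"
    unfolding near_def by (rule order_tendstoD) simp
  with eventually_hilbert eventually_Op[OF rc, of a] eventually_zero r[of 1] eventually_bounded_op[OF an]
  have "\<forall>\<^sub>F e in F. False"
  proof eventually_elim
    case (elim e)
    interpret hilbert "S e" by fact
    have "oper e a (e r) \<in> carrier (S e)" using elim bounded_opsD(1) by blast
    then show ?case
      using elim hnorm_le_hdist[of "e r" "oper e a (e r)"] hdist_commute[of "e r" "oper e a (e r)"]
      by simp
  qed
  then show False using F_neq_bot by (simp add: trivial_limit_def)
qed

lemma not_von_neumann: "\<not> von_neumann_algebra_on Hh (algebra_hull U H M)"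
proof
  assume "von_neumann_algebra_on Hh (algebra_hull U H M)"
  then have "Pop \<in> algebra_hull U H M"
    unfolding von_neumann_algebra_on_def strong_operator_topology_def
  proof (rule closedin_product_interpolation)
    show "Pop \<in> extensional (carrier Hh)" by (simp add: Pop_def)
    show "Pop \<in> bounded_ops Hh" by (rule Pop_bounded_op)
    show "\<exists>g\<in>algebra_hull U H M. \<forall>w\<in>W. g w = Pop w" if "finite W" "W \<subseteq> carrier Hh" for W
      using Pop_interpolation[OF that] unfolding algebra_hull_eq by blast
  qed
  then show False using Pop_notin_algebra_hull by blast
qed

end

theorem proposition9:
  fixes U :: "('a, 'b) nonstandard_universe"
    and \<kappa> :: "'k rel"
    and H :: "('b, 'b) inner_space"
    and M :: "('b \<Rightarrow> 'b) set"
    and p :: "nat \<Rightarrow> 'b \<Rightarrow> 'b"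
  assumes "nonstandard_universe U \<kappa>"
    and "internal_cstar_algebra_on U H M"
    and "\<And>n. p n \<in> M"
    and "\<And>n. is_projection H (p n)"
    and "\<And>n. \<exists>x\<in>carrier H. p n x \<noteq> \<zero>\<^bsub>H\<^esub>"
    and "\<And>n m x. n \<noteq> m \<Longrightarrow> x \<in> carrier H \<Longrightarrow> p n (p m x) = \<zero>\<^bsub>H\<^esub>"
  shows "\<not> von_neumann_algebra_on (hilbert_hull U H) (algebra_hull U H M)"
proof -
  obtain J \<H> K op c where
    J: "\<forall>j\<in>J. complex_hilbert_space (\<H> j) \<and> unital_cstar_algebra_on (\<H> j) (op j ` K j)"
    and c: "c \<in> set_star U J" and H: "H = hilbert_star U \<H> c" and M: "M = ops_star U \<H> K op c"
    using assms(2) unfolding internal_cstar_algebra_on_def by blast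
  interpret A: internal_algebra U \<kappa> J \<H> K op c
    by unfold_locales (use assms(1) J c in simp_all)
  \<comment> \<open>The sequence \<open>p\<close> is external; names are chosen for each standard
    \<open>n\<close> separately.\<close>
  have "\<forall>n. \<exists>k. k \<in> A.names \<and> p n = A.Op k"
    using assms(3) A.M_eq unfolding M by blast
  then obtain P where P: "\<And>n. P n \<in> A.names" "\<And>n. p n = A.Op (P n)" by metis
  interpret internal_projections U \<kappa> J \<H> K op c P
    by unfold_locales (use P(1) assms(4-6)[unfolded P(2) H] in simp_all)
  show ?thesis unfolding H M by (rule not_von_neumann)
qed

end
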